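(* There exist homotopic $C^{1+H}$ area-preserving Anosov diffeomorphisms $T_1$ and $T_2$ of $\mathbb T^2$ such that $P_{\rm top}(T_1,t\phi^u_{T_1})=P_{\rm top}(T_2,t\phi^u_{T_2})$ for all $t\in\mathbb R$, but $T_1$ and $T_2$ fail to be $C^1$ conjugate.
   Context: $\mathbb T^2=\mathbb R^2/\mathbb Z^2$. A diffeomorphism $T$ of $\mathbb T^2$ is Anosov if there is a continuous $DT$-invariant splitting of the tangent bundle $E^u\oplus E^s$ with $E^u$ uniformly expanded and $E^s$ uniformly contracted by $DT$. Area-preserving means preserving Lebesgue measure. $T$ is $C^{1+H}$ if there exists $0<\alpha<1$ such that $T$ is $C^{1+\alpha}$. The geometric potential of $T$ is $\phi^u_T(x)=-\log|D_uT(x)|$, where $|D_uT(x)|$ is the Jacobian of $T$ along $E^u$. The topological pressure of a continuous $\phi:\mathbb T^2\to\mathbb R$ is $P_{\rm top}(T,\phi)=\sup_\mu\{h_\mu(T)+\int\phi\,d\mu\}$, the supremum over $T$-invariant Borel probability measures, with $h_\mu(T)$ the measure-theoretic entropy. $T_1$ and $T_2$ are $C^1$ conjugate if there is a $C^1$ diffeomorphism $h$ of $\mathbb T^2$ with $h\circ T_1=T_2\circ h$. *)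

theory Defs
  imports "HOL-Probability.Probability"
begin

section \<open>The flat torus\<close>

quotient_type torus = "real^2" / "\<lambda>x y. \<forall>i. x $ i - y $ i \<in> \<int>"
  morphisms rep_torus torus_proj
proof (rule equivpI)
  show "reflp (\<lambda>x y :: real^2. \<forall>i. x $ i - y $ i \<in> \<int>)"
    by (auto simp: reflp_def)
  show "symp (\<lambda>x y :: real^2. \<forall>i. x $ i - y $ i \<in> \<int>)"
  proof (rule sympI, rule allI)
    fix x y :: "real^2" and i assume "\<forall>i. x $ i - y $ i \<in> \<int>"
    then have "- (x $ i - y $ i) \<in> \<int>" by (intro Ints_minus) simp
    then show "y $ i - x $ i \<in> \<int>" by simp
  qed
  show "transp (\<lambda>x y :: real^2. \<forall>i. x $ i - y $ i \<in> \<int>)"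
  proof (rule transpI, rule allI)
    fix x y z :: "real^2" and i
    assume "\<forall>i. x $ i - y $ i \<in> \<int>" "\<forall>i. y $ i - z $ i \<in> \<int>"
    then have "(x $ i - y $ i) + (y $ i - z $ i) \<in> \<int>" by (intro Ints_add) simp_all
    then show "x $ i - z $ i \<in> \<int>" by simp
  qed
qed

lemma torus_proj_eq_iff: "torus_proj x = torus_proj y \<longleftrightarrow> (\<forall>i. x $ i - y $ i \<in> \<int>)"
  by (rule torus.abs_eq_iff)

lemma torus_proj_surj: "\<exists>x. torus_proj x = p"
  by (rule torus.abs_induct[of "\<lambda>p. \<exists>x. torus_proj x = p"]) blast

lemma torus_proj_add_left: "torus_proj x = torus_proj y \<Longrightarrow> torus_proj (z + (x - y)) = torus_proj z"
  by (simp add: torus_proj_eq_iff)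

instantiation torus :: metric_space
begin

definition dist_torus :: "torus \<Rightarrow> torus \<Rightarrow> real" where
  "dist_torus p q = Inf {dist x y | x y. torus_proj x = p \<and> torus_proj y = q}"

definition uniformity_torus :: "(torus \<times> torus) filter" where
  "uniformity_torus = (INF e\<in>{0<..}. principal {(x, y). dist x y < e})"

definition open_torus :: "torus set \<Rightarrow> bool" where
  "open_torus U \<longleftrightarrow> (\<forall>x\<in>U. \<forall>\<^sub>F (x', y) in uniformity. x' = x \<longrightarrow> y \<in> U)"

lemma torus_dist_nonempty: "{dist x y | x y. torus_proj x = p \<and> torus_proj y = q} \<noteq> {}"
  using torus_proj_surj[of p] torus_proj_surj[of q] by blast

lemma torus_dist_bdd: "bdd_below {dist x y | x y. torus_proj x = p \<and> torus_proj y = q}"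
  by (rule bdd_belowI[of _ 0]) auto

lemma torus_dist_le: "dist (torus_proj x) (torus_proj y) \<le> dist x y"
  unfolding dist_torus_def by (rule cInf_lower[OF _ torus_dist_bdd]) blast

lemma torus_dist_lessD:
  assumes "dist p q < e"
  obtains x y where "torus_proj x = p" "torus_proj y = q" "dist x y < e"
  using assms cInf_lessD[OF torus_dist_nonempty, of p q e] unfolding dist_torus_def by blast

lemma torus_dist_nonneg: "0 \<le> dist p (q::torus)"
  unfolding dist_torus_def by (rule cInf_greatest[OF torus_dist_nonempty]) auto

lemma torus_dist_commute: "dist p q = dist q (p::torus)"
proof -
  have "{dist x y | x y. torus_proj x = p \<and> torus_proj y = q}
      = {dist x y | x y. torus_proj x = q \<and> torus_proj y = p}"
    using dist_commute by blast
  then show ?thesis unfolding dist_torus_def by simp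
qed

lemma torus_dist_triangle: "dist p r \<le> dist p q + dist q (r::torus)"
proof (rule field_le_epsilon)
  fix e :: real assume "0 < e"
  then have "dist p q < dist p q + e/2" "dist q r < dist q r + e/2" by auto
  then obtain x y y' z where *: "torus_proj x = p" "torus_proj y = q" "dist x y < dist p q + e/2"
     "torus_proj y' = q" "torus_proj z = r" "dist y' z < dist q r + e/2"
    by (elim torus_dist_lessD) blast
  have "torus_proj (z + (y - y')) = r"
    using torus_proj_add_left[of y y' z] * by simp
  then have "dist p r \<le> dist x (z + (y - y'))"
    using torus_dist_le[of x "z + (y - y')"] * by simp
  also have "\<dots> \<le> dist x y + dist y (z + (y - y'))" by (rule dist_triangle)
  also have "dist y (z + (y - y')) = dist y' z"
    by (simp add: dist_norm algebra_simps)
  finally show "dist p r \<le> dist p q + dist q r + e" using * by linarith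
qed

lemma torus_dist_zeroD:
  assumes "dist p q = (0::real)" shows "p = (q::torus)"
proof -
  have "dist p q < 1/2" using assms by simp
  then obtain x y where xy: "torus_proj x = p" "torus_proj y = q" "dist x y < 1/2"
    by (rule torus_dist_lessD)
  have "dist x y \<le> 0 + e" if "0 < e" for e
  proof -
    have "dist p q < min e (1/2)" using assms that by simp
    then obtain x' y' where xy': "torus_proj x' = p" "torus_proj y' = q" "dist x' y' < min e (1/2)"
      by (rule torus_dist_lessD)
    have "(x - y) $ i = (x' - y') $ i" for i
    proof -
      have "x $ i - x' $ i \<in> \<int>" "y $ i - y' $ i \<in> \<int>"
        using torus_proj_eq_iff[of x x'] torus_proj_eq_iff[of y y'] xy xy' by simp_all
      then have "(x $ i - x' $ i) - (y $ i - y' $ i) \<in> \<int>" by (rule Ints_diff)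
      moreover have "\<bar>(x - y) $ i\<bar> < 1/2" "\<bar>(x' - y') $ i\<bar> < 1/2"
        using xy(3) xy'(3) component_le_norm_cart[of "x - y" i] component_le_norm_cart[of "x' - y'" i]
        unfolding dist_norm by linarith+
      then have "\<bar>(x $ i - x' $ i) - (y $ i - y' $ i)\<bar> < 1"
        unfolding vector_minus_component by linarith
      ultimately have "(x $ i - x' $ i) - (y $ i - y' $ i) = 0"
        using Ints_nonzero_abs_less1 by blast
      then show ?thesis by simp
    qed
    then have "x - y = x' - y'" by (simp add: vec_eq_iff)
    then show ?thesis using xy' by (simp add: dist_norm)
  qed
  then have "dist x y \<le> 0" by (rule field_le_epsilon)
  then show ?thesis using xy by simp
qed

instance
proof
  fix p q r :: torus
  show "uniformity = (INF e\<in>{0<..}. principal {(x :: torus, y). dist x y < e})"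
    by (rule uniformity_torus_def)
  show "open U \<longleftrightarrow> (\<forall>x\<in>U. \<forall>\<^sub>F (x', y) in uniformity. x' = x \<longrightarrow> y \<in> U)" for U :: "torus set"
    by (rule open_torus_def)
  show "dist p q = 0 \<longleftrightarrow> p = q"
  proof
    assume "p = q"
    obtain x where "torus_proj x = p" using torus_proj_surj by blast
    then show "dist p q = 0"
      using torus_dist_le[of x x] torus_dist_nonneg[of p q] \<open>p = q\<close> by simp
  qed (rule torus_dist_zeroD)
  show "dist p q \<le> dist p r + dist q r"
    using torus_dist_triangle[of p q r] torus_dist_commute[of q r] by simp
qed

end

text \<open>The topology of this metric is the quotient topology.\<close>

lemma open_torus_iff: "open U \<longleftrightarrow> open (torus_proj -` U)"
proof
  assume U: "open U"
  show "open (torus_proj -` U)"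
    unfolding open_dist
  proof
    fix x assume "x \<in> torus_proj -` U"
    then obtain e where "e > 0" "\<And>q. dist q (torus_proj x) < e \<Longrightarrow> q \<in> U"
      using U unfolding open_dist by auto
    then show "\<exists>e>0. \<forall>y. dist y x < e \<longrightarrow> y \<in> torus_proj -` U"
      using torus_dist_le le_less_trans by (intro exI[of _ e]) blast
  qed
next
  assume V: "open (torus_proj -` U)"
  show "open U"
    unfolding open_dist
  proof
    fix p assume "p \<in> U"
    obtain x where x: "torus_proj x = p" using torus_proj_surj by blast
    then obtain e where e: "e > 0" "\<And>y. dist y x < e \<Longrightarrow> torus_proj y \<in> U"
      using V \<open>p \<in> U\<close> unfolding open_dist by auto
    have "q \<in> U" if qp: "dist q p < e" for q
    proof -
      obtain y' x' where *: "torus_proj y' = q" "torus_proj x' = p" "dist y' x' < e"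
        using qp by (rule torus_dist_lessD)
      have "torus_proj (y' + (x - x')) = q" 
        using torus_proj_add_left[of x x' y'] * x by simp
      moreover have "dist (y' + (x - x')) x < e" using * by (simp add: dist_norm)
      ultimately show ?thesis using e(2) by force
    qed
    then show "\<exists>e>0. \<forall>q. dist q p < e \<longrightarrow> q \<in> U" using e by blast
  qed
qed

definition torus_lebesgue :: "torus measure" where
  "torus_lebesgue =
     distr (restrict_space lborel {x. \<forall>i. 0 \<le> x $ i \<and> x $ i < 1}) borel torus_proj"

section \<open>Differentiable maps of the torus\<close>

definition torus_lift :: "(torus \<Rightarrow> torus) \<Rightarrow> (real^2 \<Rightarrow> real^2) \<Rightarrow> bool" where
  "torus_lift T F \<longleftrightarrow> continuous_on UNIV F \<and> (\<forall>x. torus_proj (F x) = T (torus_proj x))"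

text \<open>The tangent bundle is trivialised by \<^const>\<open>torus_proj\<close>, so that the derivative at a point
  is a matrix, namely the derivative of a lift. It depends neither on the lift nor on the
  representative of the point, see \<open>torus_deriv_eq\<close>.\<close>

definition has_torus_deriv :: "(torus \<Rightarrow> torus) \<Rightarrow> real^2^2 \<Rightarrow> torus \<Rightarrow> bool" where
  "has_torus_deriv T D p \<longleftrightarrow>
     (\<exists>F x. torus_lift T F \<and> torus_proj x = p \<and> (F has_derivative (\<lambda>v. D *v v)) (at x))"

definition torus_deriv :: "(torus \<Rightarrow> torus) \<Rightarrow> torus \<Rightarrow> real^2^2" where
  "torus_deriv T p = (THE D. has_torus_deriv T D p)"

lemma torus_lifts_diff_const:
  fixes F G :: "real^2 \<Rightarrow> real^2"
  assumes "continuous_on UNIV F" "continuous_on UNIV G"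
    and "\<And>x. torus_proj (F x) = torus_proj (G x)"
  shows "F x - F 0 = G x - G 0"
proof -
  have 1: "continuous_on UNIV (\<lambda>x. F x $ i - G x $ i)" for i
      by (intro continuous_on_diff continuous_on_component assms(1,2))
  have 2: "1 \<le> norm ((F y $ i - G y $ i) - (F x $ i - G x $ i))"
      if "F y $ i - G y $ i \<noteq> F x $ i - G x $ i" for x y i
    proof -
      have "F z $ i - G z $ i \<in> \<int>" for z
        using assms(3)[of z] unfolding torus_proj_eq_iff by simp
      from Ints_diff[OF this[of y] this[of x]]
      have "(F y $ i - G y $ i) - (F x $ i - G x $ i) \<in> \<int>" .
      then show ?thesis using that unfolding real_norm_def by (intro Ints_nonzero_abs_ge1) simp_all
    qed
  have "(\<lambda>x. F x $ i - G x $ i) constant_on UNIV" for i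
    by (rule continuous_discrete_range_constant[OF connected_UNIV 1]) (use 2 in \<open>blast intro: zero_less_one\<close>)
  then obtain c where c: "F z $ i - G z $ i = c i" for z i
    unfolding constant_on_def by (metis (no_types) UNIV_I)
  have "(F x - F 0) $ i = (G x - G 0) $ i" for i
    using c[of x i] c[of 0 i] by simp
  then show ?thesis unfolding vec_eq_iff by blast
qed

lemma has_torus_deriv_unique:
  assumes "has_torus_deriv T D p" "has_torus_deriv T D' p"
  shows "D = D'"
proof -
  obtain F x where F: "torus_lift T F" "torus_proj x = p" "(F has_derivative (\<lambda>v. D *v v)) (at x)"
    using assms(1) unfolding has_torus_deriv_def by blast
  obtain G y where G: "torus_lift T G" "torus_proj y = p" "(G has_derivative (\<lambda>v. D' *v v)) (at y)"
    using assms(2) unfolding has_torus_deriv_def by blast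
  define H where "H z = G (z + (y - x))" for z
  have "torus_proj (z + (y - x)) = torus_proj z" for z
    using torus_proj_add_left[of y x z] F(2) G(2) by simp
  then have "torus_proj (F z) = torus_proj (H z)" for z
    using F G unfolding torus_lift_def H_def by simp
  moreover have "continuous_on UNIV H"
    unfolding H_def
    by (rule continuous_on_compose2[of UNIV G])
      (use G(1) in \<open>auto simp: torus_lift_def intro: continuous_intros\<close>)
  moreover have "continuous_on UNIV F" using F(1) by (simp add: torus_lift_def)
  ultimately have F_H: "F z - F 0 = H z - H 0" for z
    by (intro torus_lifts_diff_const)
  define c where "c = F 0 - H 0"
  have "((\<lambda>z. z + (y - x)) has_derivative (\<lambda>v. v)) (at x)"
    by (auto intro!: derivative_eq_intros)
  moreover have "(G has_derivative (\<lambda>v. D' *v v)) (at (x + (y - x)))"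
    using G(3) by simp
  ultimately have "((\<lambda>z. G (z + (y - x))) has_derivative (\<lambda>v. D' *v v)) (at x)"
    by (rule has_derivative_compose)
  then have "((\<lambda>z. G (z + (y - x)) + c) has_derivative (\<lambda>v. D' *v v)) (at x)"
    by (auto intro!: derivative_eq_intros)
  moreover have "F = (\<lambda>z. G (z + (y - x)) + c)"
  proof
    fix z
    have "F z = (F z - F 0) + F 0" by simp
    also have "\<dots> = G (z + (y - x)) + c" unfolding F_H c_def by (simp add: H_def)
    finally show "F z = G (z + (y - x)) + c" .
  qed
  ultimately have "(F has_derivative (\<lambda>v. D' *v v)) (at x)" by simp
  then have "(\<lambda>v. D *v v) = (\<lambda>v. D' *v v)"
    by (rule has_derivative_unique[OF F(3)])
  then show ?thesis unfolding matrix_eq by (simp add: fun_eq_iff)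
qed

lemma torus_deriv_eq: "has_torus_deriv T D p \<Longrightarrow> torus_deriv T p = D"
  unfolding torus_deriv_def by (blast intro: has_torus_deriv_unique)

definition torus_C1 :: "(torus \<Rightarrow> torus) \<Rightarrow> bool" where
  "torus_C1 T \<longleftrightarrow> (\<forall>p. \<exists>D. has_torus_deriv T D p) \<and> continuous_on UNIV (torus_deriv T)"

definition torus_diffeo :: "(torus \<Rightarrow> torus) \<Rightarrow> bool" where
  "torus_diffeo T \<longleftrightarrow> bij T \<and> torus_C1 T \<and> torus_C1 (inv T)"

definition torus_C1_alpha :: "real \<Rightarrow> (torus \<Rightarrow> torus) \<Rightarrow> bool" where
  "torus_C1_alpha \<alpha> T \<longleftrightarrow> torus_C1 T \<and>
     (\<exists>C. \<forall>p q. norm (torus_deriv T p - torus_deriv T q) \<le> C * dist p q powr \<alpha>)"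

definition torus_C1H :: "(torus \<Rightarrow> torus) \<Rightarrow> bool" where
  "torus_C1H T \<longleftrightarrow> (\<exists>\<alpha>. 0 < \<alpha> \<and> \<alpha> < 1 \<and> torus_C1_alpha \<alpha> T)"

definition C1_conjugate :: "(torus \<Rightarrow> torus) \<Rightarrow> (torus \<Rightarrow> torus) \<Rightarrow> bool" where
  "C1_conjugate T\<^sub>1 T\<^sub>2 \<longleftrightarrow> (\<exists>h. torus_diffeo h \<and> h \<circ> T\<^sub>1 = T\<^sub>2 \<circ> h)"

section \<open>Anosov diffeomorphisms\<close>

text \<open>On the torus both summands of an Anosov splitting are line bundles: the ranks are constant by
  continuity and connectedness, and if one summand were everything, the iterates of the
  diffeomorphism would scale area uniformly by factors tending to 0 or to infinity, although they
  map the torus, which has area 1, onto itself. A line bundle is continuous if it has local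
  continuous nonvanishing sections.\<close>

definition continuous_line_bundle :: "(torus \<Rightarrow> (real^2) set) \<Rightarrow> bool" where
  "continuous_line_bundle E \<longleftrightarrow>
     (\<forall>p. \<exists>U s. open U \<and> p \<in> U \<and> continuous_on U s \<and> (\<forall>q\<in>U. s q \<noteq> 0 \<and> E q = span {s q}))"

definition anosov_splitting ::
    "(torus \<Rightarrow> torus) \<Rightarrow> (torus \<Rightarrow> (real^2) set) \<Rightarrow> (torus \<Rightarrow> (real^2) set) \<Rightarrow> bool" where
  "anosov_splitting T Eu Es \<longleftrightarrow>
     continuous_line_bundle Eu \<and> continuous_line_bundle Es \<and>
     (\<forall>p. Eu p \<inter> Es p = {0} \<and> {u + v | u v. u \<in> Eu p \<and> v \<in> Es p} = UNIV) \<and>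
     (\<forall>p. (\<lambda>v. torus_deriv T p *v v) ` Eu p = Eu (T p) \<and>
          (\<lambda>v. torus_deriv T p *v v) ` Es p = Es (T p)) \<and>
     (\<exists>C>0. \<exists>r. 0 < r \<and> r < 1 \<and>
       (\<forall>p n. (\<forall>v\<in>Eu p. norm v \<le> C * r ^ n * norm (torus_deriv (T ^^ n) p *v v)) \<and>
              (\<forall>v\<in>Es p. norm (torus_deriv (T ^^ n) p *v v) \<le> C * r ^ n * norm v)))"

definition anosov :: "(torus \<Rightarrow> torus) \<Rightarrow> bool" where
  "anosov T \<longleftrightarrow> torus_diffeo T \<and> (\<exists>Eu Es. anosov_splitting T Eu Es)"

text \<open>The splitting of an Anosov diffeomorphism is unique.\<close>

definition unstable_bundle :: "(torus \<Rightarrow> torus) \<Rightarrow> torus \<Rightarrow> (real^2) set" where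
  "unstable_bundle T = (THE Eu. \<exists>Es. anosov_splitting T Eu Es)"

text \<open>The Jacobian along a line is the factor by which lengths on the line are scaled.\<close>

definition unstable_jacobian :: "(torus \<Rightarrow> torus) \<Rightarrow> torus \<Rightarrow> real" where
  "unstable_jacobian T p =
     (THE J. \<forall>v\<in>unstable_bundle T p. norm (torus_deriv T p *v v) = J * norm v)"

definition geometric_potential :: "(torus \<Rightarrow> torus) \<Rightarrow> torus \<Rightarrow> real" where
  "geometric_potential T p = - ln (unstable_jacobian T p)"

section \<open>Invariant measures, entropy and pressure\<close>

definition preserves_measure :: "('a \<Rightarrow> 'a) \<Rightarrow> 'a measure \<Rightarrow> bool" where
  "preserves_measure T M \<longleftrightarrow> T \<in> measurable M M \<and> distr M M T = M"

definition finite_measurable_partition :: "'a measure \<Rightarrow> 'a set set \<Rightarrow> bool" where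
  "finite_measurable_partition M \<xi> \<longleftrightarrow>
     finite \<xi> \<and> \<xi> \<subseteq> sets M \<and> disjoint \<xi> \<and> \<Union>\<xi> = space M"

text \<open>Note that \<open>0 * ln 0 = 0\<close>.\<close>

definition partition_entropy :: "'a measure \<Rightarrow> 'a set set \<Rightarrow> real" where
  "partition_entropy M \<xi> = - (\<Sum>A\<in>\<xi>. measure M A * ln (measure M A))"

text \<open>The join of the partitions \<open>\<xi>\<close>, \<open>T\<^sup>-\<^sup>1 \<xi>\<close>, \dots, \<open>T\<^sup>-\<^sup>(\<^sup>n\<^sup>-\<^sup>1\<^sup>) \<xi>\<close>; empty cells are harmless.\<close>

definition iterated_join :: "'a measure \<Rightarrow> ('a \<Rightarrow> 'a) \<Rightarrow> 'a set set \<Rightarrow> nat \<Rightarrow> 'a set set" where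
  "iterated_join M T \<xi> n =
     {(\<Inter>i<n. (T ^^ i) -` A i) \<inter> space M | A. \<forall>i<n. A i \<in> \<xi>}"

definition entropy_wrt_partition :: "'a measure \<Rightarrow> ('a \<Rightarrow> 'a) \<Rightarrow> 'a set set \<Rightarrow> real" where
  "entropy_wrt_partition M T \<xi> = lim (\<lambda>n. partition_entropy M (iterated_join M T \<xi> n) / real n)"

definition measure_entropy :: "'a measure \<Rightarrow> ('a \<Rightarrow> 'a) \<Rightarrow> ereal" where
  "measure_entropy M T =
     (SUP \<xi>\<in>{\<xi>. finite_measurable_partition M \<xi>}. ereal (entropy_wrt_partition M T \<xi>))"

definition invariant_prob_measures :: "('a::topological_space \<Rightarrow> 'a) \<Rightarrow> 'a measure set" where
  "invariant_prob_measures T =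
     {M. sets M = sets borel \<and> prob_space M \<and> preserves_measure T M}"

definition topological_pressure :: "('a::topological_space \<Rightarrow> 'a) \<Rightarrow> ('a \<Rightarrow> real) \<Rightarrow> ereal" where
  "topological_pressure T \<phi> =
     (SUP M\<in>invariant_prob_measures T. measure_entropy M T + ereal (\<integral>x. \<phi> x \<partial>M))"

end

theory Submission
  imports Defs
begin

text \<open>
  The examples are two compositions of shears that are time reversals of each other. For circle maps
  \<open>f, k\<close> of degree 3 with derivative at least 1, let \<open>T\<^sub>1\<close> be the shear \<open>(x, y) \<mapsto> (x, y + f x)\<close> followed
  by \<open>(x, y) \<mapsto> (x + k y, y)\<close>. Its derivative is a positive matrix of determinant 1, which yields the
  Anosov splitting by contracting slopes. With the rotation \<open>g (x, y) = (- y, x)\<close>, the map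
  \<open>T\<^sub>2 = g \<circ> T\<^sub>1\<^sup>-\<^sup>1 \<circ> g\<^sup>-\<^sup>1\<close> is of the same form, with \<open>f\<close> and \<open>k\<close> replaced by \<open>y \<mapsto> - k (- y)\<close> and \<open>f\<close>,
  and so it is homotopic to \<open>T\<^sub>1\<close>. Pushing forward by \<open>g\<close> identifies the invariant measures and keeps
  the entropies; by preservation of area, the geometric potentials are cohomologous up to this
  identification, so the two pressures agree term by term.

  A \<open>C\<^sup>1\<close> conjugacy \<open>h\<close> preserves the traces at fixed points. The fixed points are the nine points of order dividing 3,
  and \<open>f, k\<close> are chosen so that the traces of \<open>T\<^sub>1\<close> at them are pairwise different; hence \<open>h\<close> agrees
  with \<open>g\<close> on them. A lift of \<open>h\<close> would act on the lattice by a matrix that commutes with the linear part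
  \<open>A\<close> of \<open>T\<^sub>1\<close> and is congruent to a matrix anticommuting with \<open>(A - 1) / 3\<close> modulo 3, which is impossible.
\<close>

section \<open>Vectors and matrices of dimension two\<close>

lemma vec2_eq_iff: "(v :: 'a^2) = w \<longleftrightarrow> v $ 1 = w $ 1 \<and> v $ 2 = w $ 2"
  by (simp add: vec_eq_iff forall_2)

lemma vector_2_eta: "vector [v $ 1, v $ 2] = (v :: 'a::zero^2)"
  by (simp add: vec2_eq_iff)

lemma continuous_on_vector_2 [continuous_intros]:
  fixes f g :: "'a::topological_space \<Rightarrow> 'b::{topological_space, zero}"
  assumes "continuous_on S f" "continuous_on S g"
  shows "continuous_on S (\<lambda>x. vector [f x, g x] :: 'b^2)"
proof -
  have "continuous_on S (\<lambda>x. if i = 1 then f x else g x)" for i :: 2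
    using assms by (cases "i = 1") simp_all
  then have "continuous_on S (\<lambda>x. (\<chi> i. if i = 1 then f x else g x) :: 'b^2)"
    by (rule continuous_on_vec_lambda)
  moreover have "(\<lambda>x. vector [f x, g x] :: 'b^2) = (\<lambda>x. \<chi> i. if i = 1 then f x else g x)"
    by (auto simp: fun_eq_iff vec_eq_iff forall_2)
  ultimately show ?thesis by (simp only:)
qed

lemma has_derivative_vector_2 [derivative_intros]:
  fixes f g :: "'a::euclidean_space \<Rightarrow> real"
  assumes "(f has_derivative f') (at x within S)" "(g has_derivative g') (at x within S)"
  shows "((\<lambda>x. vector [f x, g x] :: real^2) has_derivative (\<lambda>v. vector [f' v, g' v])) (at x within S)"
  using assms
  by (auto simp: has_derivative_componentwise_within[of "\<lambda>x. vector [f x, g x] :: real^2"]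
        Basis_vec_def inner_axis forall_2)

lemma matrix_vector_mult_2:
  "vector [vector [a, b], vector [c, d]] *v (v :: real^2)
     = (vector [a * v $ 1 + b * v $ 2, c * v $ 1 + d * v $ 2] :: real^2)"
  by (simp add: vec2_eq_iff matrix_vector_mult_def sum_2)

lemma norm_vec2_le: "norm (v :: 'a::real_normed_vector^2) \<le> norm (v $ 1) + norm (v $ 2)"
  by (simp add: norm_vec_def L2_set_def sum_2 sqrt_sum_squares_le_sum)

lemma norm_mat2_le: "norm (vector [vector [a, b], vector [c, d]] :: real^2^2) \<le> \<bar>a\<bar> + \<bar>b\<bar> + \<bar>c\<bar> + \<bar>d\<bar>"
proof -
  have "norm (vector [a, b] :: real^2) \<le> \<bar>a\<bar> + \<bar>b\<bar>" "norm (vector [c, d] :: real^2) \<le> \<bar>c\<bar> + \<bar>d\<bar>"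
    using norm_vec2_le[of "vector [a, b] :: real^2"] norm_vec2_le[of "vector [c, d] :: real^2"] by simp_all
  then show ?thesis
    using norm_vec2_le[of "vector [vector [a, b], vector [c, d]] :: real^2^2"] by simp
qed

section \<open>Continuous and differentiable maps of the torus\<close>

lemma continuous_torus_proj: "continuous_on UNIV torus_proj"
  by (simp add: continuous_on_open_vimage open_torus_iff)

lemma torus_proj_rep [simp]: "torus_proj (rep_torus p) = p"
  by (rule Quotient3_abs_rep[OF Quotient3_torus])

text \<open>\<open>torus_proj\<close> is a quotient map, so continuity on the torus can be checked
  on the plane.\<close>

lemma torus_continuousI:
  assumes "continuous_on UNIV (\<lambda>v. f (torus_proj v))"
  shows "continuous_on (UNIV :: torus set) f"
  using assms by (simp add: continuous_on_open_vimage open_torus_iff vimage_def)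

text \<open>Lattice translations are isometries, so a pair of representatives at distance below
  \<open>e\<close> can be translated until the first one is the given \<open>x\<close>.\<close>

lemma torus_lift_near:
  assumes "dist (torus_proj x) q < e"
  obtains y where "torus_proj y = q" "dist x y < e"
proof -
  obtain x' y' where *: "torus_proj x' = torus_proj x" "torus_proj y' = q" "dist x' y' < e"
    using assms by (rule torus_dist_lessD)
  have "torus_proj (y' + (x - x')) = q"
    using torus_proj_add_left[of x x' y'] * by simp
  moreover have "dist x (y' + (x - x')) < e" 
    using *(3) by (simp add: dist_norm algebra_simps)
  ultimately show thesis by (rule that)
qed

lemma torus_proj_shift: "\<forall>i. n $ i \<in> \<int> \<Longrightarrow> torus_proj (x + n) = torus_proj x"
  by (simp add: torus_proj_eq_iff)

text \<open>A version of \<open>torus_continuousI\<close> with a parameter, meant for homotopies. It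
  rests on the fact that nearby points of the torus have nearby representatives.\<close>

lemma torus_continuous_pairI:
  fixes G :: "'a::metric_space \<Rightarrow> real^2 \<Rightarrow> 'b::metric_space"
  assumes G: "continuous_on (S \<times> UNIV) (\<lambda>(t, x). G t x)"
    and f: "\<And>t x. t \<in> S \<Longrightarrow> f (t, torus_proj x) = G t x"
  shows "continuous_on (S \<times> UNIV) f"
  unfolding continuous_on_iff
proof (intro ballI allI impI)
  fix z :: "'a \<times> torus" and e :: real assume z: "z \<in> S \<times> UNIV" and e: "0 < e"
  define x where "x = rep_torus (snd z)"
  have zx: "z = (fst z, torus_proj x)" by (simp add: x_def)
  have "(fst z, x) \<in> S \<times> UNIV" using z by auto
  then obtain d where d: "d > 0" 
    "\<And>w. w \<in> S \<times> UNIV \<Longrightarrow> dist w (fst z, x) < d \<Longrightarrow> dist (case w of (t, x) \<Rightarrow> G t x) (G (fst z) x) < e"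
    using G e unfolding continuous_on_iff by (smt (verit) case_prod_conv)
  show "\<exists>d>0. \<forall>w\<in>S \<times> UNIV. dist w z < d \<longrightarrow> dist (f w) (f z) < e"
  proof (intro exI[of _ "d/2"] conjI ballI impI)
    fix w assume w: "w \<in> S \<times> UNIV" "dist w z < d/2"
    have "dist (fst w) (fst z) < d/2" "dist (snd w) (snd z) < d/2"
      using w(2) dist_fst_le[of w z] dist_snd_le[of w z] by linarith+
    moreover obtain y where y: "torus_proj y = snd w" "dist x y < d/2"
      using torus_lift_near[of x "snd w" "d/2"] \<open>dist (snd w) (snd z) < d/2\<close> zx
      by (metis dist_commute snd_conv)
    moreover have "dist (fst w, y) (fst z, x) \<le> dist (fst w) (fst z) + dist y x"
      using sqrt_sum_squares_le_sum[of "dist (fst w) (fst z)" "dist y x"] by (simp add: dist_Pair_Pair)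
    ultimately have "dist (fst w, y) (fst z, x) < d" by (simp add: dist_commute)
    then have "dist (G (fst w) y) (G (fst z) x) < e" using d(2)[of "(fst w, y)"] w(1) by auto
    moreover have "f w = G (fst w) y" using f[of "fst w" y] w(1) y(1) by auto
    moreover have "f z = G (fst z) x" using f[of "fst z" x] z zx by auto
    ultimately show "dist (f w) (f z) < e" by simp
  qed (use d in simp)
qed

text \<open>Translating the argument of a lift by a lattice vector moves the representative from the
  definition to the prescribed \<open>x\<close>.\<close>

lemma has_torus_derivD:
  assumes "has_torus_deriv T D (torus_proj x)"
  obtains F where "torus_lift T F" "(F has_derivative (\<lambda>v. D *v v)) (at x)"
proof -
  obtain F y where F: "torus_lift T F" "torus_proj y = torus_proj x" "(F has_derivative (\<lambda>v. D *v v)) (at y)"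
    using assms unfolding has_torus_deriv_def by blast
  show thesis
  proof
    show "torus_lift T (\<lambda>z. F (z + (y - x)))"
      using F(1) torus_proj_add_left[OF F(2)] unfolding torus_lift_def
      by (auto intro!: continuous_on_compose2[of UNIV F] continuous_intros)
    have "((\<lambda>z. z + (y - x)) has_derivative (\<lambda>v. v)) (at x)"
      by (auto intro!: derivative_eq_intros)
    moreover have "(F has_derivative (\<lambda>v. D *v v)) (at (x + (y - x)))"
      using F(3) by simp
    ultimately show "((\<lambda>z. F (z + (y - x))) has_derivative (\<lambda>v. D *v v)) (at x)"
      by (rule has_derivative_compose)
  qed
qed

lemma has_torus_deriv_compose:
  assumes "has_torus_deriv T D p" "has_torus_deriv S E (T p)"
  shows "has_torus_deriv (S \<circ> T) (E ** D) p"
proof -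
  obtain F x where F: "torus_lift T F" "torus_proj x = p" "(F has_derivative (\<lambda>v. D *v v)) (at x)"
    using assms(1) unfolding has_torus_deriv_def by blast
  have "has_torus_deriv S E (torus_proj (F x))"
    using assms(2) F by (auto simp: torus_lift_def)
  then obtain G where G: "torus_lift S G" "(G has_derivative (\<lambda>v. E *v v)) (at (F x))"
    by (rule has_torus_derivD)
  have "torus_lift (S \<circ> T) (\<lambda>z. G (F z))"
    using F(1) G(1) unfolding torus_lift_def by (auto intro!: continuous_on_compose2[of UNIV G])
  moreover have "((\<lambda>z. G (F z)) has_derivative (\<lambda>v. (E ** D) *v v)) (at x)"
    using has_derivative_compose[OF F(3) G(2)] by (simp add: matrix_vector_mul_assoc)
  ultimately show ?thesis using F(2) unfolding has_torus_deriv_def by blast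
qed

lemma has_torus_deriv_id: "has_torus_deriv id (mat 1) p"
proof -
  have "(*v) (mat 1) = (\<lambda>v :: real^2. v)" by auto
  then show ?thesis
    unfolding has_torus_deriv_def
    by (intro exI[of _ "\<lambda>x. x"] exI[of _ "rep_torus p"]) (simp add: torus_lift_def)
qed

lemma has_torus_deriv_torus_deriv:
  "torus_C1 T \<Longrightarrow> has_torus_deriv T (torus_deriv T p) p"
  unfolding torus_C1_def by (metis torus_deriv_eq)

lemma torus_C1I:
  assumes "\<And>p. has_torus_deriv T (D p) p" "continuous_on UNIV D"
  shows "torus_C1 T" "torus_deriv T p = D p"
proof -
  have "torus_deriv T = D" using torus_deriv_eq[OF assms(1)] by blast
  then show "torus_C1 T" "torus_deriv T p = D p" using assms by (auto simp: torus_C1_def)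
qed

section \<open>Invariant slopes\<close>

text \<open>The matrix with rows \<open>(1 + a * b, b)\<close> and \<open>(a, 1)\<close> maps the
  vector \<open>(1, t)\<close> to a multiple of \<open>(1, t')\<close> with
  \<open>t' = (a + t) / (1 + b * (a + t))\<close>. Nonnegative slopes land in the unit interval, and
  the stretching factor is at least 2.\<close>

lemma slope_update_bounds:
  fixes a b t :: real
  assumes "1 \<le> a" "1 \<le> b" "0 \<le> t"
  shows "0 \<le> (a + t) / (1 + b * (a + t))" "(a + t) / (1 + b * (a + t)) \<le> 1" "2 \<le> 1 + b * (a + t)"
proof -
  have "1 * 1 \<le> b * (a + t)" using assms by (intro mult_mono) auto
  then show "2 \<le> 1 + b * (a + t)" by simp
  have "1 * (a + t) \<le> b * (a + t)" using assms by (intro mult_right_mono) auto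
  then have "a + t \<le> 1 + b * (a + t)" by simp
  with \<open>2 \<le> 1 + b * (a + t)\<close>
  show "(a + t) / (1 + b * (a + t)) \<le> 1" by (subst divide_le_eq_1_pos) auto
  show "0 \<le> (a + t) / (1 + b * (a + t))"
    using assms \<open>2 \<le> 1 + b * (a + t)\<close> by (intro divide_nonneg_nonneg) auto
qed

text \<open>The matrix has determinant 1, so two updated slopes differ by
  \<open>(t - u) / (A * B)\<close>, where both denominators are at least 2.\<close>

lemma slope_update_contraction:
  fixes a b t u :: real
  assumes "1 \<le> a" "1 \<le> b" "0 \<le> t" "0 \<le> u"
  shows "\<bar>(a + t) / (1 + b * (a + t)) - (a + u) / (1 + b * (a + u))\<bar> \<le> 1/4 * \<bar>t - u\<bar>"
proof -
  define A B where "A = 1 + b * (a + t)" and "B = 1 + b * (a + u)"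
  have AB: "2 \<le> A" "2 \<le> B"
    using slope_update_bounds(3) assms by (auto simp: A_def B_def)
  have "2 * 2 \<le> A * B" using AB by (intro mult_mono) auto
  moreover have "(a + t) / A - (a + u) / B = (t - u) / (A * B)"
    using AB by (simp add: divide_simps) (simp add: A_def B_def algebra_simps)
  moreover have "\<bar>t - u\<bar> / (A * B) \<le> \<bar>t - u\<bar> / 4"
    using \<open>2 * 2 \<le> A * B\<close> by (intro divide_left_mono) auto
  ultimately have "\<bar>(a + t) / A - (a + u) / B\<bar> \<le> \<bar>t - u\<bar> / 4"
    using AB by (simp add: abs_mult)
  then show ?thesis by (simp add: A_def B_def)
qed

text \<open>A graph transform: the slope update is a contraction of the bounded continuous
  functions, and its fixed point is an invariant line field. \<open>R\<close> is left open, as it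
  will be the inverse map for the expanding slopes and the map itself for the contracting
  ones.\<close>

lemma invariant_slope_exists:
  fixes a b :: "torus \<Rightarrow> real" and R :: "torus \<Rightarrow> torus"
  assumes cont: "continuous_on UNIV a" "continuous_on UNIV b" "continuous_on UNIV R"
    and ge: "\<And>p. 1 \<le> a p" "\<And>p. 1 \<le> b p"
  obtains s where "continuous_on UNIV s" "\<And>p. 0 \<le> s p" "\<And>p. s p \<le> 1"
    "\<And>p. s p = (a p + s (R p)) / (1 + b p * (a p + s (R p)))"
proof -
  \<comment> \<open>The absolute value extends the update to all bounded continuous functions, so
    that no invariant subset has to be singled out. It disappears at the fixed point, which is
    nonnegative.\<close>
  define \<Phi> where "\<Phi> s p = (a p + \<bar>s (R p)\<bar>) / (1 + b p * (a p + \<bar>s (R p)\<bar>))" for s p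
  have \<Phi>_bounds: "0 \<le> \<Phi> s p" "\<Phi> s p \<le> 1" for s p
    using slope_update_bounds[OF ge, of "\<bar>s (R p)\<bar>" p p] by (auto simp: \<Phi>_def)
  have nz: "1 + b p * (a p + \<bar>t\<bar>) \<noteq> 0" for p t
    using slope_update_bounds(3)[OF ge, of "\<bar>t\<bar>" p p] by simp
  have \<Phi>_cont: "\<Phi> s \<in> bcontfun" if "continuous_on UNIV s" for s
  proof (rule bcontfun_normI[where b = 1])
    have "continuous_on UNIV (\<lambda>p. s (R p))"
      using that cont(3) by (rule continuous_on_compose2) simp
    then show "continuous_on UNIV (\<Phi> s)"
      unfolding \<Phi>_def using cont nz by (intro continuous_intros) auto
  qed (use \<Phi>_bounds in auto)
  have "\<exists>!s. Bcontfun (\<Phi> (apply_bcontfun s)) = s"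
  proof (rule banach_fix_type[where c = "1/4"], safe)
    fix s t :: "torus \<Rightarrow>\<^sub>C real"
    show "dist (Bcontfun (\<Phi> s)) (Bcontfun (\<Phi> t)) \<le> 1/4 * dist s t"
    proof (rule dist_bound)
      fix p
      have "\<bar>\<Phi> s p - \<Phi> t p\<bar> \<le> 1/4 * \<bar>\<bar>s (R p)\<bar> - \<bar>t (R p)\<bar>\<bar>"
        unfolding \<Phi>_def by (rule slope_update_contraction) (auto simp: ge)
      also have "\<dots> \<le> 1/4 * dist (s (R p)) (t (R p))"
        by (simp add: dist_real_def)
      also have "\<dots> \<le> 1/4 * dist s t" using dist_bounded by simp
      finally show "dist (Bcontfun (\<Phi> s) p) (Bcontfun (\<Phi> t) p) \<le> 1/4 * dist s t"
        by (simp add: Bcontfun_inverse \<Phi>_cont dist_real_def)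
    qed
  qed auto
  then obtain S where "Bcontfun (\<Phi> (apply_bcontfun S)) = S" by blast
  then have S: "apply_bcontfun S = \<Phi> (apply_bcontfun S)"
    using Bcontfun_inverse[OF \<Phi>_cont, of "apply_bcontfun S"] by simp
  show thesis
  proof
    have ge0: "0 \<le> S p" for p using S \<Phi>_bounds(1) by metis
    then show "0 \<le> S p" for p .
    show "S p \<le> 1" for p using S \<Phi>_bounds(2) by metis
    show "S p = (a p + S (R p)) / (1 + b p * (a p + S (R p)))" for p
      using fun_cong[OF S, of p] ge0 by (simp add: \<Phi>_def)
  qed simp
qed

section \<open>Anosov splittings given by slopes\<close>

text \<open>\<open>a\<close> and \<open>b\<close> are the derivatives of the two shears. The
  expanding line at \<open>p\<close> is spanned by \<open>(1, s p)\<close> and the contracting one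
  by \<open>(- \<sigma> p, 1)\<close>; \<open>s_eq\<close> and \<open>\<sigma>_eq\<close> express
  that the derivative and its inverse preserve these line fields.\<close>

locale slope_system =
  fixes T :: "torus \<Rightarrow> torus" and a b s \<sigma> :: "torus \<Rightarrow> real"
  assumes diffeo: "torus_diffeo T"
    and deriv: "has_torus_deriv T (vector [vector [1 + a p * b p, b p], vector [a p, 1]]) p"
    and cont: "continuous_on UNIV s" "continuous_on UNIV \<sigma>"
    and ge_1: "1 \<le> a p" "1 \<le> b p"
    and slope_bounds: "0 \<le> s p" "s p \<le> 1" "0 \<le> \<sigma> p" "\<sigma> p \<le> 1"
    and s_eq: "s (T p) = (a p + s p) / (1 + b p * (a p + s p))"
    and \<sigma>_eq: "\<sigma> p = (b p + \<sigma> (T p)) / (1 + a p * (b p + \<sigma> (T p)))"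
begin

definition u where "u p = (vector [1, s p] :: real^2)"
definition w where "w p = (vector [- \<sigma> p, 1] :: real^2)"
text \<open>\<open>A\<close> is the factor by which the derivative stretches \<open>u\<close>, and
  \<open>1 / B\<close> the factor by which it shrinks \<open>w\<close>; see \<open>D_u\<close> and
  \<open>D_w\<close>.\<close>

definition A where "A p = 1 + b p * (a p + s p)"
definition B where "B p = 1 + a p * (b p + \<sigma> (T p))"
definition D where "D p = (vector [vector [1 + a p * b p, b p], vector [a p, 1]] :: real^2^2)"

lemma A_ge: "2 \<le> A p" and B_ge: "2 \<le> B p"
  unfolding A_def B_def by (intro slope_update_bounds(3) ge_1 slope_bounds)+

lemma deriv_eq: "torus_deriv T p = D p"
  unfolding D_def by (rule torus_deriv_eq[OF deriv])

lemma D_u: "D p *v u p = A p *\<^sub>R u (T p)"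
  using A_ge[of p] s_eq[of p]
  by (simp add: D_def u_def vec2_eq_iff matrix_vector_mult_2 A_def[symmetric])
    (simp add: A_def algebra_simps)

lemma D_w: "D p *v w p = (1 / B p) *\<^sub>R w (T p)"
proof -
  have "B p * \<sigma> p = b p + \<sigma> (T p)"
    using B_ge[of p] \<sigma>_eq[of p] by (simp add: B_def[symmetric])
  then have "B p * (1 - a p * \<sigma> p) = 1" "B p * (b p - (1 + a p * b p) * \<sigma> p) = - \<sigma> (T p)"
    unfolding B_def by algebra+
  then show ?thesis
    using B_ge[of p] 
    by (simp add: D_def w_def vec2_eq_iff matrix_vector_mult_2 field_simps)
qed

text \<open>The vectors \<open>u p\<close> and \<open>w p\<close> span a parallelogram of area \<open>1 + s p * \<sigma> p\<close>, and \<open>D p\<close> has determinant 1.\<close>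

lemma A_B: "A p * (1 + s (T p) * \<sigma> (T p)) = B p * (1 + s p * \<sigma> p)"
proof -
  have "A p * s (T p) = a p + s p" "B p * \<sigma> p = b p + \<sigma> (T p)"
    using A_ge[of p] s_eq[of p] B_ge[of p] \<sigma>_eq[of p] by (simp_all add: A_def[symmetric] B_def[symmetric])
  then show ?thesis unfolding A_def B_def by algebra
qed

lemma bij: "bij T" using diffeo by (simp add: torus_diffeo_def)

section \<open>Iterates of the derivative and the Anosov estimates\<close>

definition Dn where "Dn n p = torus_deriv (T ^^ n) p"

text \<open>\<open>torus_deriv\<close> is a definite description, so the chain rule for iterates
  needs existence first.\<close>

lemma has_deriv_iterate: "\<exists>D'. has_torus_deriv (T ^^ n) D' p"
  proof (induction n)
  case 0
  then show ?case using has_torus_deriv_id[of p] by (auto simp: id_def)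
next
  case (Suc n)
  then show ?case using has_torus_deriv_compose[OF _ deriv] by (metis funpow.simps(2))
qed

lemma Dn_0: "Dn 0 p = mat 1"
  unfolding Dn_def using torus_deriv_eq[OF has_torus_deriv_id] by (simp add: id_def)

lemma Dn_Suc: "Dn (Suc n) p = D ((T ^^ n) p) ** Dn n p"
proof -
  obtain D' where D': "has_torus_deriv (T ^^ n) D' p" using has_deriv_iterate by blast
  have "has_torus_deriv (T \<circ> (T ^^ n)) (D ((T ^^ n) p) ** D') p"
    using has_torus_deriv_compose[OF D' deriv] by (simp add: D_def)
  then show ?thesis
    unfolding Dn_def using torus_deriv_eq D' by (metis funpow.simps(2))
qed

lemma Dn_u: "\<exists>c\<ge>2 ^ n. Dn n p *v u p = c *\<^sub>R u ((T ^^ n) p)"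
proof (induction n)
  case 0 then show ?case by (auto simp: Dn_0)
next
  case (Suc n)
  then obtain c where c: "c \<ge> 2 ^ n" "Dn n p *v u p = c *\<^sub>R u ((T ^^ n) p)" by blast
  have "Dn (Suc n) p *v u p = (A ((T ^^ n) p) * c) *\<^sub>R u ((T ^^ Suc n) p)"
    using c(2) by (simp add: Dn_Suc matrix_vector_mul_assoc[symmetric] matrix_vector_mult_scaleR D_u)
  moreover have "2 * 2 ^ n \<le> A ((T ^^ n) p) * c" using c(1) A_ge[of "(T ^^ n) p"] by (intro mult_mono) auto
  ultimately show ?case by (auto intro!: exI[of _ "A ((T ^^ n) p) * c"])
qed

lemma Dn_w: "\<exists>c. 0 < c \<and> c \<le> (1/2) ^ n \<and> Dn n p *v w p = c *\<^sub>R w ((T ^^ n) p)"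
proof (induction n)
  case 0 then show ?case by (auto simp: Dn_0 intro!: exI[of _ 1])
next
  case (Suc n)
  then obtain c where c: "0 < c" "c \<le> (1/2) ^ n" "Dn n p *v w p = c *\<^sub>R w ((T ^^ n) p)" by blast
  define e where "e = 1 / B ((T ^^ n) p)"
  have e: "0 < e" "e \<le> 1/2" using B_ge[of "(T ^^ n) p"] by (auto simp: e_def divide_simps)
  have "Dn (Suc n) p *v w p = (e * c) *\<^sub>R w ((T ^^ Suc n) p)"
    using c(3) by (simp add: Dn_Suc matrix_vector_mul_assoc[symmetric] matrix_vector_mult_scaleR D_w e_def)
  moreover have "e * c \<le> (1/2) * (1/2) ^ n" using c e by (intro mult_mono) auto
  ultimately show ?case using c(1) e(1) by (intro exI[of _ "e * c"]) auto
qed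

lemma norm_u: "1 \<le> norm (u p)" "norm (u p) \<le> 2" and norm_w: "1 \<le> norm (w p)" "norm (w p) \<le> 2"
proof -
  show "1 \<le> norm (u p)" "1 \<le> norm (w p)"
    using component_le_norm_cart[of "u p" 1] component_le_norm_cart[of "w p" 2]
    by (simp_all add: u_def w_def)
  show "norm (u p) \<le> 2" "norm (w p) \<le> 2"
    using norm_vec2_le[of "u p"] norm_vec2_le[of "w p"] slope_bounds[of p]
    by (simp_all add: u_def w_def)
qed

lemma image_span_singleton:
  assumes "M *v x = c *\<^sub>R y" "c \<noteq> 0"
  shows "(\<lambda>v. M *v v) ` span {x} = span {y :: real^2}"
proof
  show "(\<lambda>v. M *v v) ` span {x} \<subseteq> span {y}"
    using assms(1) by (auto simp: span_singleton matrix_vector_mult_scaleR)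
  have "k *\<^sub>R y = M *v ((k / c) *\<^sub>R x)" for k
    using assms by (simp add: matrix_vector_mult_scaleR)
  then show "span {y} \<subseteq> (\<lambda>v. M *v v) ` span {x}"
    by (auto simp: span_singleton)
qed

text \<open>Cramer's rule for the basis \<open>u p\<close>, \<open>w p\<close>, whose determinant is
  \<open>1 + s p * \<sigma> p\<close>.\<close>

lemma decompose: "v = ((v $ 1 + \<sigma> p * v $ 2) / (1 + s p * \<sigma> p)) *\<^sub>R u p
                     + ((v $ 2 - s p * v $ 1) / (1 + s p * \<sigma> p)) *\<^sub>R w p"
proof -
  have "0 < 1 + s p * \<sigma> p" using slope_bounds[of p] by (simp add: add_pos_nonneg)
  then show ?thesis 
    by (simp add: vec2_eq_iff u_def w_def divide_simps) (simp add: algebra_simps)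
qed

lemma anosov_splitting: "anosov_splitting T (\<lambda>p. span {u p}) (\<lambda>p. span {w p})"
  unfolding anosov_splitting_def
proof (intro conjI allI)
  have nz: "u p \<noteq> 0" "w p \<noteq> 0" for p using norm_u(1)[of p] norm_w(1)[of p] by auto
  have "continuous_on UNIV u" "continuous_on UNIV w"
    unfolding u_def w_def by (intro continuous_intros cont)+
  then show "continuous_line_bundle (\<lambda>p. span {u p})" "continuous_line_bundle (\<lambda>p. span {w p})"
    unfolding continuous_line_bundle_def using nz by (metis UNIV_I open_UNIV)+
  show "span {u p} \<inter> span {w p} = {0}" for p
  proof -
    have "k *\<^sub>R u p = l *\<^sub>R w p \<Longrightarrow> k = 0" for k l
    proof -
      assume "k *\<^sub>R u p = l *\<^sub>R w p"
      then have "k = - (l * \<sigma> p)" "k * s p = l" by (auto simp: vec2_eq_iff u_def w_def)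
      then have "k * (1 + s p * \<sigma> p) = 0" by algebra
      moreover have "0 < 1 + s p * \<sigma> p" using slope_bounds[of p] by (simp add: add_pos_nonneg)
      ultimately show "k = 0" by simp
    qed
    then show ?thesis
      using span_zero[of "{u p}"] span_zero[of "{w p}"] by (force simp: span_singleton)
  qed
  show "{x + y | x y. x \<in> span {u p} \<and> y \<in> span {w p}} = UNIV" for p
    using decompose[of _ p] by (auto simp: span_singleton)
  show "(\<lambda>v. torus_deriv T p *v v) ` span {u p} = span {u (T p)}" for p
    unfolding deriv_eq using A_ge[of p] by (intro image_span_singleton[OF D_u]) auto
  show "(\<lambda>v. torus_deriv T p *v v) ` span {w p} = span {w (T p)}" for p
    unfolding deriv_eq using B_ge[of p] by (intro image_span_singleton[OF D_w]) auto
  \<comment> \<open>The rate \<open>1/2\<close> comes from \<open>A_ge\<close> and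
    \<open>B_ge\<close>, and the constant 2 from the norms of \<open>u\<close> and \<open>w\<close>,
    which lie between 1 and 2.\<close>
  have 1: "norm v \<le> 2 * (1/2) ^ n * norm (torus_deriv (T ^^ n) p *v v)" if v: "v \<in> span {u p}" for n p v
  proof -
    obtain k where k: "v = k *\<^sub>R u p" using v by (auto simp: span_singleton)
    obtain c where c: "c \<ge> 2 ^ n" "Dn n p *v u p = c *\<^sub>R u ((T ^^ n) p)" using Dn_u by blast
    have "0 < c" using c(1) by (rule less_le_trans[rotated]) simp
    have "norm v \<le> \<bar>k\<bar> * 2" unfolding k using norm_u(2)[of p] by (simp add: mult_left_mono)
    also have "\<dots> = \<bar>k\<bar> * (2 * ((1/2) ^ n * 2 ^ n) * 1)" by (simp add: power_mult_distrib[symmetric])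
    also have "\<dots> \<le> \<bar>k\<bar> * (2 * ((1/2) ^ n * c) * norm (u ((T ^^ n) p)))"
      using c \<open>0 < c\<close> norm_u(1)[of "(T ^^ n) p"] by (intro mult_mono) auto
    also have "\<dots> = 2 * (1/2) ^ n * norm (k *\<^sub>R (c *\<^sub>R u ((T ^^ n) p)))" using \<open>0 < c\<close> by (simp add: abs_mult)
    also have "\<dots> = 2 * (1/2) ^ n * norm (torus_deriv (T ^^ n) p *v v)"
      unfolding k c(2)[symmetric] by (simp add: matrix_vector_mult_scaleR Dn_def)
    finally show ?thesis .
  qed
  have 2: "norm (torus_deriv (T ^^ n) p *v v) \<le> 2 * (1/2) ^ n * norm v" if v: "v \<in> span {w p}" for n p v
  proof -
    obtain k where k: "v = k *\<^sub>R w p" using v by (auto simp: span_singleton)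
    obtain c where c: "0 < c" "c \<le> (1/2) ^ n" "Dn n p *v w p = c *\<^sub>R w ((T ^^ n) p)" using Dn_w by blast
    have "torus_deriv (T ^^ n) p *v v = k *\<^sub>R (c *\<^sub>R w ((T ^^ n) p))"
      unfolding k c(3)[symmetric] by (simp add: matrix_vector_mult_scaleR Dn_def)
    then have "norm (torus_deriv (T ^^ n) p *v v) = \<bar>k\<bar> * (c * norm (w ((T ^^ n) p)))" 
      using c(1) by (simp add: abs_mult)
    also have "\<dots> \<le> \<bar>k\<bar> * ((1/2) ^ n * 2)"
      using c norm_w(2)[of "(T ^^ n) p"] by (intro mult_mono) auto
    also have "\<dots> \<le> \<bar>k\<bar> * ((1/2) ^ n * 2) * norm (w p)"
      using mult_left_mono[OF norm_w(1)[of p], of "\<bar>k\<bar> * ((1/2) ^ n * 2)"] by simp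
    also have "\<dots> = 2 * (1/2) ^ n * norm v" by (simp add: k)
    finally show ?thesis .
  qed
  show "\<exists>C>0. \<exists>r. 0 < r \<and> r < 1 \<and>
       (\<forall>p n. (\<forall>v\<in>span {u p}. norm v \<le> C * r ^ n * norm (torus_deriv (T ^^ n) p *v v)) \<and>
              (\<forall>v\<in>span {w p}. norm (torus_deriv (T ^^ n) p *v v) \<le> C * r ^ n * norm v))"
    by (rule exI[of _ 2], rule conjI, simp, rule exI[of _ "1/2"]) (use 1 2 in auto)
qed

lemma anosov: "anosov T"
  using diffeo anosov_splitting unfolding anosov_def by blast

text \<open>The expression \<open>v $ 2 - s p * v $ 1\<close> is the determinant of the pair
  \<open>u p\<close>, \<open>v\<close>. The derivative preserves determinants and stretches
  \<open>u\<close> by \<open>A\<close>, so each step divides the quantity by a number that is at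
  least 2.\<close>

lemma Dn_det: "\<bar>(Dn n p *v v) $ 2 - s ((T ^^ n) p) * (Dn n p *v v) $ 1\<bar> \<le> \<bar>v $ 2 - s p * v $ 1\<bar>"
proof (induction n)
  case 0 then show ?case by (simp add: Dn_0)
next
  case (Suc n)
  define q x where "q = (T ^^ n) p" and "x = Dn n p *v v"
  have step: "Dn (Suc n) p *v v = D q *v x"
    by (simp add: Dn_Suc matrix_vector_mul_assoc[symmetric] q_def x_def)
  have "A q * ((D q *v x) $ 2 - s (T q) * (D q *v x) $ 1) = x $ 2 - s q * x $ 1"
  proof -
    have "A q * s (T q) = a q + s q"
      using A_ge[of q] s_eq[of q] by (simp add: A_def[symmetric])
    then show ?thesis unfolding D_def matrix_vector_mult_2 vector_2 A_def by algebra
  qed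
  then have "A q * \<bar>(D q *v x) $ 2 - s (T q) * (D q *v x) $ 1\<bar> = \<bar>x $ 2 - s q * x $ 1\<bar>"
    using A_ge[of q] by (metis abs_mult abs_of_nonneg order_trans zero_le_numeral)
  moreover have "z \<le> y" if "A q * z = y" "0 \<le> z" for y z
    using mult_right_mono[OF A_ge[of q] that(2)] that by linarith
  ultimately have "\<bar>(D q *v x) $ 2 - s (T q) * (D q *v x) $ 1\<bar> \<le> \<bar>x $ 2 - s q * x $ 1\<bar>"
    using abs_ge_zero by blast
  then show ?case using Suc step by (simp add: q_def x_def)
qed

text \<open>A vector of an expanding bundle has backward iterates that shrink exponentially. Their
  determinants against \<open>u\<close> shrink too and, by \<open>Dn_det\<close>, do not grow on the
  way forward. So the vector is parallel to \<open>u\<close>.\<close>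

lemma splitting_unique:
  assumes "anosov_splitting T E E'"
  shows "E = (\<lambda>p. span {u p})"
proof
  fix p
  obtain C r where C: "C > 0" and r: "0 < r" "r < 1"
    and exp: "\<And>p n v. v \<in> E p \<Longrightarrow> norm v \<le> C * r ^ n * norm (torus_deriv (T ^^ n) p *v v)"
    using assms unfolding anosov_splitting_def by metis
  have inv: "(\<lambda>v. D p *v v) ` E p = E (T p)" for p
    using assms unfolding anosov_splitting_def deriv_eq by blast
  have inv_n: "(\<lambda>v. Dn n q *v v) ` E q = E ((T ^^ n) q)" for n q
  proof (induction n)
    case 0 then show ?case by (simp add: Dn_0)
  next
    case (Suc n)
    have "(\<lambda>v. Dn (Suc n) q *v v) ` E q = (\<lambda>v. D ((T ^^ n) q) *v v) ` (\<lambda>v. Dn n q *v v) ` E q"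
      by (simp add: image_image Dn_Suc matrix_vector_mul_assoc)
    then show ?case using Suc inv by simp
  qed
  have sub: "v = v $ 1 *\<^sub>R u p" if v: "v \<in> E p" for v
  proof -
    have "\<bar>v $ 2 - s p * v $ 1\<bar> \<le> 2 * C * norm v * r ^ n" for n
    proof -
      obtain q where q: "(T ^^ n) q = p" 
        using bij_fn[OF bij, of n] by (metis bij_pointE)
      then obtain x where x: "x \<in> E q" "v = Dn n q *v x" using inv_n[where q=q and n=n] v by blast
      have "\<bar>v $ 2 - s p * v $ 1\<bar> \<le> \<bar>x $ 2 - s q * x $ 1\<bar>"
        using Dn_det[of n q x] x(2) q by simp
      also have "\<dots> \<le> \<bar>x $ 2\<bar> + s q * \<bar>x $ 1\<bar>"
        using slope_bounds[of q] by (metis abs_mult abs_of_nonneg abs_triangle_ineq4)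
      also have "\<dots> \<le> norm x + 1 * norm x"
        using slope_bounds[of q] by (intro add_mono mult_mono component_le_norm_cart) auto
      also have "\<dots> \<le> 2 * (C * r ^ n * norm v)"
        using exp[OF x(1), of n] x(2) by (simp add: Dn_def)
      finally show ?thesis by (simp add: mult_ac)
    qed
    moreover have "(\<lambda>n. 2 * C * norm v * r ^ n) \<longlonglongrightarrow> 2 * C * norm v * 0"
      using r by (intro tendsto_mult tendsto_const LIMSEQ_realpow_zero) auto
    ultimately have "\<bar>v $ 2 - s p * v $ 1\<bar> \<le> 0"
      by (intro LIMSEQ_le_const[of "\<lambda>n. 2 * C * norm v * r ^ n"]) auto
    then show ?thesis by (simp add: vec2_eq_iff u_def)
  qed
  \<comment> \<open>Both spaces are lines, so the inclusion becomes an equality.\<close>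
  obtain y where y: "y \<noteq> 0" "E p = span {y}"
    using assms unfolding anosov_splitting_def continuous_line_bundle_def by metis
  then have y_u: "y = y $ 1 *\<^sub>R u p" using sub by (simp add: span_base)
  then have "y $ 1 \<noteq> 0" using y(1) by (metis scale_zero_left)
  then show "E p = span {u p}"
    using image_span_singleton[of "mat 1" y "y $ 1" "u p"] y y_u by simp
qed

lemma unstable_bundle: "unstable_bundle T p = span {u p}"
proof -
  have "unstable_bundle T = (\<lambda>p. span {u p})"
    unfolding unstable_bundle_def
    by (rule the_equality) (use anosov_splitting splitting_unique in blast)+
  then show ?thesis by simp
qed

text \<open>\<open>u\<close> is not normalised, hence the Jacobian is \<open>A\<close> corrected by
  a quotient of norms. The logarithm of the correction is a coboundary and leaves integrals against
  invariant measures unchanged.\<close>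

lemma geometric_potential:
  "geometric_potential T p = - ln (A p) - ln (norm (u (T p))) + ln (norm (u p))"
proof -
  define J where "J = A p * norm (u (T p)) / norm (u p)"
  have pos: "0 < norm (u q)" "0 < A q" for q using norm_u(1)[of q] A_ge[of q] by linarith+
  have "unstable_jacobian T p = J"
    unfolding unstable_jacobian_def unstable_bundle deriv_eq
  proof (rule the_equality)
    show "\<forall>v\<in>span {u p}. norm (D p *v v) = J * norm v"
      using A_ge[of p] norm_u(1)[of p]
      by (auto simp: span_singleton matrix_vector_mult_scaleR D_u J_def abs_mult)
    fix J' assume "\<forall>v\<in>span {u p}. norm (D p *v v) = J' * norm v"
    then have "norm (D p *v u p) = J' * norm (u p)" by (simp add: span_base)
    then show "J' = J" using A_ge[of p] pos[of p] by (simp add: D_u J_def field_simps)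
  qed
  then show ?thesis
    using pos[of p] pos[of "T p"] by (simp add: geometric_potential_def J_def ln_div ln_mult)
qed

end

section \<open>Pressure and time reversal\<close>

text \<open>\<open>conj\<close> says that \<open>g\<close> conjugates \<open>T\<close> to the
  inverse of \<open>S\<close>. The inverses are explicit so that images of Borel sets under
  \<open>T\<close> and \<open>g\<close> are Borel, being preimages under \<open>T'\<close> and
  \<open>g'\<close>.\<close>

locale reversing_conjugacy =
  fixes T T' S S' g g' :: "'a::topological_space \<Rightarrow> 'a"
  assumes meas [measurable]: "T \<in> borel \<rightarrow>\<^sub>M borel" "T' \<in> borel \<rightarrow>\<^sub>M borel"
      "S \<in> borel \<rightarrow>\<^sub>M borel" "S' \<in> borel \<rightarrow>\<^sub>M borel" "g \<in> borel \<rightarrow>\<^sub>M borel" "g' \<in> borel \<rightarrow>\<^sub>M borel"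
    and inverse: "\<And>x. T' (T x) = x" "\<And>x. T (T' x) = x" "\<And>x. S' (S x) = x" "\<And>x. S (S' x) = x"
      "\<And>x. g' (g x) = x" "\<And>x. g (g' x) = x"
    and conj: "\<And>x. S (g (T x)) = g x"
begin

lemma bij: "bij T" "bij g"
  by (rule o_bij[of T' T], simp_all add: fun_eq_iff inverse)
    (rule o_bij[of g' g], simp_all add: fun_eq_iff inverse)

lemma image_eq: "T ` X = T' -` X" "g ` X = g' -` X"
  by (auto simp: inverse intro: image_eqI[where x = "T' x" for x] image_eqI[where x = "g' x" for x])

lemma funpow_meas [measurable]: "T ^^ n \<in> borel \<rightarrow>\<^sub>M borel" "T' ^^ n \<in> borel \<rightarrow>\<^sub>M borel"
  by (induction n) (auto intro: measurable_comp meas simp: id_def)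

lemma funpow_inverse: "(T' ^^ n) ((T ^^ n) x) = x" "(T ^^ n) ((T' ^^ n) x) = x"
  by (induction n arbitrary: x) (simp_all add: inverse funpow_swap1)

lemma funpow_image_eq: "(T ^^ n) ` X = (T' ^^ n) -` X"
proof (intro equalityI subsetI)
  fix x assume "x \<in> (T' ^^ n) -` X"
  then have "(T ^^ n) ((T' ^^ n) x) \<in> (T ^^ n) ` X" by blast
  then show "x \<in> (T ^^ n) ` X" by (simp add: funpow_inverse)
qed (auto simp: funpow_inverse)

text \<open>Each application of \<open>S\<close> cancels one application of \<open>T\<close>, as
  time runs backwards under \<open>g\<close>.\<close>

lemma conj_funpow: "j \<le> k \<Longrightarrow> (S ^^ j) (g ((T ^^ k) x)) = g ((T ^^ (k - j)) x)"
proof (induction j)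
  case (Suc j)
  then have "k - j = Suc (k - Suc j)" by simp
  then show ?case using Suc conj by simp
qed simp

context
  fixes M :: "'a measure"
  assumes M: "M \<in> invariant_prob_measures T"
begin

lemma sets_M [measurable_cong]: "sets M = sets borel" and prob_M: "prob_space M"
  and distr_M: "distr M M T = M"
  using M by (auto simp: invariant_prob_measures_def preserves_measure_def)

lemma space_M: "space M = UNIV"
  using sets_eq_imp_space_eq[OF sets_M] by simp

text \<open>By \<open>conj\<close>, \<open>g = S \<circ> g \<circ> T\<close>, and the innermost
  \<open>T\<close> leaves \<open>M\<close> unchanged.\<close>

lemma push_invariant: "distr M borel g \<in> invariant_prob_measures S"
proof -
  interpret prob_space M by (rule prob_M)
  have "distr M borel g = distr (distr M M T) borel (S \<circ> g)"
    by (subst distr_distr) (auto simp: comp_def conj)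
  also have "\<dots> = distr (distr M borel g) borel S"
    by (simp add: distr_M distr_distr)
  finally have "distr (distr M borel g) (distr M borel g) S = distr M borel g"
    by (metis distr_cong sets_distr)
  then show ?thesis
    by (auto simp: invariant_prob_measures_def preserves_measure_def intro!: prob_space_distr)
qed

lemma measure_funpow_image: 
  assumes "X \<in> sets borel" shows "measure M ((T ^^ n) ` X) = measure M X"
proof (induction n)
  case (Suc n)
  have *: "(T ^^ n) ` X \<in> sets borel"
    using measurable_sets[OF funpow_meas(2) assms] by (simp add: funpow_image_eq)
  have "measure M (T ` (T ^^ n) ` X) = measure (distr M M T) (T ` (T ^^ n) ` X)"
    by (simp add: distr_M)
  also have "\<dots> = measure M (T -` (T ` (T ^^ n) ` X) \<inter> space M)"
    using measurable_sets[OF meas(2) *] by (intro measure_distr) (auto simp: image_eq sets_M)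
  also have "\<dots> = measure M ((T ^^ n) ` X)"
    using bij by (simp add: space_M inj_vimage_image_eq bij_is_inj)
  finally show ?case using Suc by (simp add: image_comp)
qed simp

text \<open>The orbit of \<open>g ((T ^^ k) x)\<close> under \<open>S\<close> runs through the
  images of the first \<open>k + 1\<close> points of the orbit of \<open>x\<close> in reverse order.
  So the joins correspond under \<open>g \<circ> (T ^^ k)\<close>, with the index \<open>i\<close>
  reversed to \<open>k - i\<close>.\<close>

lemma iterated_join_push:
  "iterated_join (distr M borel g) S ((`) g ` \<xi>) (Suc k)
     = (`) (g \<circ> (T ^^ k)) ` iterated_join M T \<xi> (Suc k)"
proof -
  have cell: "(\<Inter>i<Suc k. (S ^^ i) -` (g ` A (k - i))) = (g \<circ> (T ^^ k)) ` (\<Inter>i<Suc k. (T ^^ i) -` A i)" for A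
  proof (intro equalityI subsetI)
    fix y assume y: "y \<in> (\<Inter>i<Suc k. (S ^^ i) -` (g ` A (k - i)))"
    define x where "x = (T' ^^ k) (g' y)"
    have y_x: "y = g ((T ^^ k) x)" by (simp add: x_def funpow_inverse inverse)
    have "(T ^^ i) x \<in> A i" if "i < Suc k" for i
    proof -
      have "(S ^^ (k - i)) y \<in> g ` A i" using that y by (auto dest!: bspec[of _ _ "k - i"])
      then show ?thesis
        using that conj_funpow[of "k - i" k x] bij(2) by (simp add: y_x inj_image_mem_iff bij_is_inj)
    qed
    then show "y \<in> (g \<circ> (T ^^ k)) ` (\<Inter>i<Suc k. (T ^^ i) -` A i)" using y_x by auto
  next
    fix y assume "y \<in> (g \<circ> (T ^^ k)) ` (\<Inter>i<Suc k. (T ^^ i) -` A i)"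
    then obtain x where "y = g ((T ^^ k) x)" "\<And>i. i < Suc k \<Longrightarrow> (T ^^ i) x \<in> A i" by auto
    then show "y \<in> (\<Inter>i<Suc k. (S ^^ i) -` (g ` A (k - i)))"
      using conj_funpow by auto
  qed
  show ?thesis
  proof (intro equalityI subsetI)
    fix C assume "C \<in> iterated_join (distr M borel g) S ((`) g ` \<xi>) (Suc k)"
    then obtain A where A: "C = (\<Inter>i<Suc k. (S ^^ i) -` A i)" "\<forall>i<Suc k. A i \<in> (`) g ` \<xi>"
      by (auto simp: iterated_join_def)
    from A(2) obtain A' where A': "\<And>i. i < Suc k \<Longrightarrow> A i = g ` A' i \<and> A' i \<in> \<xi>"
      by (simp add: image_iff Bex_def) metis
    \<comment> \<open>Reversing the index twice brings the intersection into the form required by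
      \<open>cell\<close>.\<close>
    have "C = (\<Inter>i<Suc k. (S ^^ i) -` (g ` A' (k - (k - i))))"
      unfolding A(1) using A' by (intro INF_cong) auto
    also have "\<dots> = (g \<circ> (T ^^ k)) ` (\<Inter>i<Suc k. (T ^^ i) -` A' (k - i))"
      by (rule cell)
    finally show "C \<in> (`) (g \<circ> (T ^^ k)) ` iterated_join M T \<xi> (Suc k)"
      using A' unfolding iterated_join_def space_M
      by (intro image_eqI[where x = "\<Inter>i<Suc k. (T ^^ i) -` A' (k - i)"])
         (auto intro!: exI[of _ "\<lambda>i. A' (k - i)"])
  next
    fix C assume "C \<in> (`) (g \<circ> (T ^^ k)) ` iterated_join M T \<xi> (Suc k)"
    then obtain A where A: "C = (g \<circ> (T ^^ k)) ` (\<Inter>i<Suc k. (T ^^ i) -` A i)" "\<forall>i<Suc k. A i \<in> \<xi>"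
      by (auto simp: iterated_join_def space_M)
    show "C \<in> iterated_join (distr M borel g) S ((`) g ` \<xi>) (Suc k)"
      unfolding iterated_join_def A(1) cell[symmetric] using A(2)
      by (auto intro!: exI[of _ "\<lambda>i. g ` A (k - i)"])
  qed
qed

lemma finite_measurable_partition_push:
  assumes "finite_measurable_partition M \<xi>"
  shows "finite_measurable_partition (distr M borel g) ((`) g ` \<xi>)"
  unfolding finite_measurable_partition_def
proof (intro conjI)
  have \<xi>: "finite \<xi>" "\<xi> \<subseteq> sets borel" "disjoint \<xi>" "\<Union>\<xi> = UNIV"
    using assms by (auto simp: finite_measurable_partition_def sets_M space_M)
  show "finite ((`) g ` \<xi>)" using \<xi> by simp
  show "(`) g ` \<xi> \<subseteq> sets (distr M borel g)"
    using \<xi>(2) measurable_sets[OF meas(6)] by (auto simp: image_eq)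
  show "disjoint ((`) g ` \<xi>)"
    using \<xi>(3) bij(2) by (intro disjoint_image) (auto simp: bij_def inj_on_def)
  show "\<Union>((`) g ` \<xi>) = space (distr M borel g)"
    using \<xi>(4) bij(2) by (simp add: bij_is_surj flip: image_Union)
qed

text \<open>The map \<open>g \<circ> (T ^^ k)\<close> is injective and carries \<open>M\<close> to
  the pushed measure, so corresponding cells of the two joins have equal mass.\<close>

lemma entropy_push:
  assumes "finite_measurable_partition M \<xi>"
  shows "entropy_wrt_partition (distr M borel g) S ((`) g ` \<xi>) = entropy_wrt_partition M T \<xi>"
proof -
  have "partition_entropy (distr M borel g) (iterated_join (distr M borel g) S ((`) g ` \<xi>) (Suc k))
     = partition_entropy M (iterated_join M T \<xi> (Suc k))" for k
  proof -
    define e where "e = g \<circ> (T ^^ k)"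
    have "inj e" unfolding e_def using bij bij_fn by (intro inj_compose) (auto simp: bij_is_inj)
    then have inj: "inj_on ((`) e) (iterated_join M T \<xi> (Suc k))"
      by (meson inj_image_eq_iff inj_onI)
    have "measure (distr M borel g) (e ` C) = measure M C" if C: "C \<in> iterated_join M T \<xi> (Suc k)" for C
    proof -
      from C obtain A where A: "C = (\<Inter>i<Suc k. (T ^^ i) -` A i)" "\<forall>i<Suc k. A i \<in> sets borel"
        using assms by (auto simp: iterated_join_def finite_measurable_partition_def sets_M space_M subset_iff)
      have "(T ^^ i) -` A i \<in> sets borel" if "i < Suc k" for i
        using measurable_sets[OF funpow_meas(1), of "A i"] A(2) that by simp
      then have C_sets: "C \<in> sets borel" unfolding A(1) by (intro sets.countable_INT') auto
      have e_C: "e ` C = g ` (T ^^ k) ` C" by (simp add: e_def image_comp)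
      have "e ` C \<in> sets borel"
        using measurable_sets[OF meas(6), of "(T ^^ k) ` C"] measurable_sets[OF funpow_meas(2) C_sets]
        unfolding e_C image_eq(2) funpow_image_eq by simp
      then have "measure (distr M borel g) (e ` C) = measure M (g -` (e ` C) \<inter> space M)"
        by (intro measure_distr) simp_all
      also have "\<dots> = measure M ((T ^^ k) ` C)"
        unfolding e_C space_M using bij(2) by (simp add: inj_vimage_image_eq bij_is_inj)
      also have "\<dots> = measure M C"
        by (rule measure_funpow_image[OF C_sets])
      finally show ?thesis .
    qed
    then show ?thesis
      unfolding partition_entropy_def iterated_join_push e_def[symmetric]
      by (simp add: sum.reindex[OF inj])
  qed
  \<comment> \<open>For \<open>n = 0\<close> both quotients are divisions by zero and hence
    0.\<close>
  then have "partition_entropy (distr M borel g) (iterated_join (distr M borel g) S ((`) g ` \<xi>) n) / real n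
     = partition_entropy M (iterated_join M T \<xi> n) / real n" for n
    by (cases n) auto
  then show ?thesis unfolding entropy_wrt_partition_def by (simp only:)
qed

lemma measure_entropy_push_le: "measure_entropy M T \<le> measure_entropy (distr M borel g) S"
  unfolding measure_entropy_def
proof (rule SUP_least, safe)
  fix \<xi> assume "finite_measurable_partition M \<xi>"
  then show "ereal (entropy_wrt_partition M T \<xi>) 
      \<le> (SUP \<xi>\<in>{\<xi>. finite_measurable_partition (distr M borel g) \<xi>}.
            ereal (entropy_wrt_partition (distr M borel g) S \<xi>))"
    using finite_measurable_partition_push entropy_push
    by (intro SUP_upper2[of "(`) g ` \<xi>"]) auto
qed

end

lemma topological_pressure_le:
  assumes "\<And>M. M \<in> invariant_prob_measures T \<Longrightarrow> (\<integral>x. \<phi> x \<partial>M) = (\<integral>x. \<psi> x \<partial>distr M borel g)"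
  shows "topological_pressure T \<phi> \<le> topological_pressure S \<psi>"
  unfolding topological_pressure_def
proof (rule SUP_least)
  fix M assume M: "M \<in> invariant_prob_measures T"
  show "measure_entropy M T + ereal (\<integral>x. \<phi> x \<partial>M)
     \<le> (SUP M\<in>invariant_prob_measures S. measure_entropy M S + ereal (\<integral>x. \<psi> x \<partial>M))"
    using measure_entropy_push_le[OF M] push_invariant[OF M]
    by (intro SUP_upper2[of "distr M borel g"]) (auto simp: assms[OF M] intro: add_right_mono)
qed

lemma reverse: "reversing_conjugacy S S' T T' g' g"
proof
  show "T (g' (S x)) = g' x" for x
    using conj[of "g' (S x)"] conj[of "T' (g' (S x))"] conj[of "T' (g' x)"] inverse by metis
qed (use meas inverse in auto)

text \<open>This is \<open>topological_pressure_le\<close> in both directions. Each invariant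
  measure of \<open>S\<close> is the push-forward by \<open>g\<close> of its own push-forward by
  \<open>g'\<close>, which turns the hypothesis into the one for the reversed direction.\<close>

lemma topological_pressure_eq:
  assumes eq: "\<And>M. M \<in> invariant_prob_measures T \<Longrightarrow> (\<integral>x. \<phi> x \<partial>M) = (\<integral>x. \<psi> x \<partial>distr M borel g)"
  shows "topological_pressure T \<phi> = topological_pressure S \<psi>"
proof (rule antisym)
  show "topological_pressure T \<phi> \<le> topological_pressure S \<psi>"
    by (rule topological_pressure_le[OF eq])
  interpret rev: reversing_conjugacy S S' T T' g' g by (rule reverse)
  show "topological_pressure S \<psi> \<le> topological_pressure T \<phi>"
  proof (rule rev.topological_pressure_le)
    fix N assume N: "N \<in> invariant_prob_measures S"
    have sets_N [measurable_cong]: "sets N = sets borel"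
      using N by (simp add: invariant_prob_measures_def)
    have "distr (distr N borel g') borel g = distr N borel (g \<circ> g')"
      by (rule distr_distr) (simp_all add: measurable_cong_sets[OF sets_N refl] meas)
    also have "\<dots> = distr N N (\<lambda>x. x)"
      by (rule distr_cong) (auto simp: inverse sets_N)
    also have "\<dots> = N" by (rule distr_id)
    finally show "(\<integral>x. \<psi> x \<partial>N) = (\<integral>x. \<phi> x \<partial>distr N borel g')"
      using eq[OF rev.push_invariant[OF N]] by simp
  qed
qed

end

section \<open>Maps of the torus given by periodic lifts\<close>

text \<open>A chosen representative makes this total; \<open>F\<close> is a lift of the result if it
  is continuous and satisfies \<open>respects_lattice\<close>.\<close>

definition torus_map :: "(real^2 \<Rightarrow> real^2) \<Rightarrow> torus \<Rightarrow> torus" where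
  "torus_map F p = torus_proj (F (rep_torus p))"

definition respects_lattice :: "(real^2 \<Rightarrow> real^2) \<Rightarrow> bool" where
  "respects_lattice F \<longleftrightarrow> (\<forall>x n. (\<forall>i. n $ i \<in> \<int>) \<longrightarrow> torus_proj (F (x + n)) = torus_proj (F x))"

lemma torus_map_proj:
  assumes "respects_lattice F" shows "torus_map F (torus_proj x) = torus_proj (F x)"
proof -
  define n where "n = rep_torus (torus_proj x) - x"
  have "torus_proj (rep_torus (torus_proj x)) = torus_proj x" by simp
  then have "\<forall>i. n $ i \<in> \<int>" unfolding n_def torus_proj_eq_iff by simp
  then have "torus_proj (F (x + n)) = torus_proj (F x)"
    using assms unfolding respects_lattice_def by blast
  then show ?thesis by (simp add: torus_map_def n_def)
qed

lemma torus_lift_map: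
  "respects_lattice F \<Longrightarrow> continuous_on UNIV F \<Longrightarrow> torus_lift (torus_map F) F"
  by (simp add: torus_lift_def torus_map_proj)

lemma torus_dist_le_2: "dist p q \<le> (2 :: real)" for p q :: torus
proof -
  obtain x y where xy: "torus_proj x = p" "torus_proj y = q" using torus_proj_surj by metis
  define z where "z = y + (\<chi> i. of_int \<lfloor>x $ i - y $ i\<rfloor>)"
  have "torus_proj z = q" unfolding z_def xy(2)[symmetric] by (rule torus_proj_shift) simp
  then have "dist p q \<le> dist x z" using torus_dist_le xy(1) by metis
  also have "\<dots> \<le> \<bar>x $ 1 - z $ 1\<bar> + \<bar>x $ 2 - z $ 2\<bar>"
    using norm_vec2_le[of "x - z"] by (simp add: dist_norm)
  also have "\<dots> \<le> 1 + 1"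
  proof -
    have "\<bar>x $ i - z $ i\<bar> \<le> 1" for i
      unfolding z_def by simp linarith
    then show ?thesis by (intro add_mono)
  qed
  finally show ?thesis by simp
qed

text \<open>A Lipschitz bound on the plane passes to the torus via representatives whose distance is
  almost that of the points. As the torus is bounded, it then gives a Hoelder bound with exponent
  \<open>1/2\<close>.\<close>

lemma torus_lipschitz_imp_holder:
  fixes f :: "torus \<Rightarrow> 'a::real_normed_vector"
  assumes L: "\<And>x y. norm (f (torus_proj x) - f (torus_proj y)) \<le> L * dist x y" "0 \<le> L"
  shows "norm (f p - f q) \<le> (2 * L) * dist p q powr (1/2)"
proof -
  have "norm (f p - f q) \<le> L * dist p q + e" if "0 < e" for e
  proof -
    \<comment> \<open>The denominator \<open>L + 1\<close> instead of \<open>L\<close> covers the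
      case \<open>L = 0\<close>.\<close>
    define d where "d = e / (L + 1)"
    have d: "0 < d" "L * d \<le> e" using that L(2) by (auto simp: d_def field_simps)
    obtain x y where xy: "torus_proj x = p" "torus_proj y = q" "dist x y < dist p q + d"
      using torus_dist_lessD[of p q "dist p q + d"] d(1) by auto
    have "norm (f p - f q) \<le> L * dist x y" using L(1)[of x y] xy by simp
    also have "\<dots> \<le> L * (dist p q + d)" using xy(3) L(2) by (intro mult_left_mono) auto
    finally show ?thesis using d(2) by (simp add: algebra_simps)
  qed
  then have "norm (f p - f q) \<le> L * dist p q" by (rule field_le_epsilon)
  also have "dist p q \<le> 2 * sqrt (dist p q)"
  proof -
    have "dist p q = sqrt (dist p q) * sqrt (dist p q)" by simp
    also have "\<dots> \<le> 2 * sqrt (dist p q)"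
      using torus_dist_le_2[of p q] by (intro mult_right_mono real_le_lsqrt) auto
    finally show ?thesis .
  qed
  then have "L * dist p q \<le> L * (2 * sqrt (dist p q))"
    using L(2) by (rule mult_left_mono)
  finally show ?thesis by (simp add: powr_half_sqrt mult_ac)
qed

section \<open>Expanding circle maps\<close>

text \<open>The perturbation vanishes at the thirds of integers, where the derivative is \<open>4 + \<delta> * sin (2 * pi * x)\<close>
  and therefore takes three different values.\<close>

definition circle_map :: "real \<Rightarrow> real \<Rightarrow> real" where
  "circle_map \<delta> x = 3 * x + sin (6 * pi * x) * (1 + \<delta> * sin (2 * pi * x)) / (6 * pi)"

definition circle_deriv :: "real \<Rightarrow> real \<Rightarrow> real" where
  "circle_deriv \<delta> x =
     3 + cos (6 * pi * x) * (1 + \<delta> * sin (2 * pi * x)) + \<delta> / 3 * (sin (6 * pi * x) * cos (2 * pi * x))"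

lemma has_real_derivative_circle_map:
  "(circle_map \<delta> has_real_derivative circle_deriv \<delta> x) (at x within S)"
  unfolding circle_map_def[abs_def] circle_deriv_def
  by (auto intro!: derivative_eq_intros simp: field_simps)

lemma has_derivative_circle_map [derivative_intros]:
  "(f has_derivative f') (at x within S) \<Longrightarrow>
    ((\<lambda>x. circle_map \<delta> (f x)) has_derivative (\<lambda>h. circle_deriv \<delta> (f x) * f' h)) (at x within S)"
  by (subst mult.commute) (rule DERIV_compose_FDERIV[OF has_real_derivative_circle_map])

lemma continuous_on_circle_map [continuous_intros]:
  fixes f :: "'a::t2_space \<Rightarrow> real"
  shows "continuous_on S f \<Longrightarrow> continuous_on S (\<lambda>x. circle_map \<delta> (f x))"
  unfolding circle_map_def by (intro continuous_intros) auto

lemma continuous_on_circle_deriv [continuous_intros]: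
  fixes f :: "'a::t2_space \<Rightarrow> real"
  shows "continuous_on S f \<Longrightarrow> continuous_on S (\<lambda>x. circle_deriv \<delta> (f x))"
  unfolding circle_deriv_def by (intro continuous_intros)

lemma sin_cos_int_period:
  assumes "k \<in> \<int>"
  shows "sin (y + 2 * pi * k) = sin y" "cos (y + 2 * pi * k) = cos y"
  using assms by (auto simp: sin_add cos_add elim!: Ints_cases)

lemma circle_map_shift: "n \<in> \<int> \<Longrightarrow> circle_map \<delta> (x + n) = circle_map \<delta> x + 3 * n"
  and circle_deriv_shift: "n \<in> \<int> \<Longrightarrow> circle_deriv \<delta> (x + n) = circle_deriv \<delta> x"
proof -
  assume n: "n \<in> \<int>"
  then have n3: "3 * n \<in> \<int>" by simp
  have "6 * pi * (x + n) = 6 * pi * x + 2 * pi * (3 * n)" "2 * pi * (x + n) = 2 * pi * x + 2 * pi * n"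
    by (simp_all add: algebra_simps)
  then have "sin (6 * pi * (x + n)) = sin (6 * pi * x)" "cos (6 * pi * (x + n)) = cos (6 * pi * x)"
    "sin (2 * pi * (x + n)) = sin (2 * pi * x)" "cos (2 * pi * (x + n)) = cos (2 * pi * x)"
    using sin_cos_int_period[OF n3] sin_cos_int_period[OF n] by presburger+
  then show "circle_map \<delta> (x + n) = circle_map \<delta> x + 3 * n"
    "circle_deriv \<delta> (x + n) = circle_deriv \<delta> x"
    by (simp_all add: circle_map_def circle_deriv_def algebra_simps)
qed

text \<open>Reflection changes the sign of \<open>\<delta>\<close>; the sign in the parameters of
  the reversed map comes from here.\<close>

lemma circle_map_minus: "circle_map \<delta> (- x) = - circle_map (- \<delta>) x"
  and circle_deriv_minus: "circle_deriv \<delta> (- x) = circle_deriv (- \<delta>) x"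
  by (simp_all add: circle_map_def circle_deriv_def)

lemma abs_mult_le: "\<bar>x\<bar> \<le> A \<Longrightarrow> \<bar>y\<bar> \<le> B \<Longrightarrow> \<bar>x * y\<bar> \<le> A * (B :: real)"
  unfolding abs_mult by (rule mult_mono) auto

text \<open>The oscillating terms deviate from 3 by at most \<open>7/4 + 1/4 = 2\<close>. The lower
  bound 1 is what the slope estimates require.\<close>

lemma circle_deriv_bounds:
  assumes "\<bar>\<delta>\<bar> \<le> 3/4" shows "1 \<le> circle_deriv \<delta> x" "circle_deriv \<delta> x \<le> 5"
proof -
  have "\<bar>\<delta> * sin (2 * pi * x)\<bar> \<le> 3/4 * 1" 
    by (intro abs_mult_le assms abs_sin_le_one)
  then have "\<bar>1 + \<delta> * sin (2 * pi * x)\<bar> \<le> 7/4" by linarith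
  then have "\<bar>cos (6 * pi * x) * (1 + \<delta> * sin (2 * pi * x))\<bar> \<le> 1 * (7/4)"
    by (intro abs_mult_le abs_cos_le_one)
  moreover have "\<bar>\<delta> / 3 * (sin (6 * pi * x) * cos (2 * pi * x))\<bar> \<le> 1/4 * (1 * 1)"
    by (intro abs_mult_le abs_sin_le_one abs_cos_le_one) (use assms in simp)
  ultimately show "1 \<le> circle_deriv \<delta> x" "circle_deriv \<delta> x \<le> 5"
    unfolding circle_deriv_def by linarith+
qed

lemma real_lipschitz_if_deriv_bounded:
  fixes f :: "real \<Rightarrow> real"
  assumes "\<And>x. (f has_real_derivative f' x) (at x)" "\<And>x. \<bar>f' x\<bar> \<le> L"
  shows "\<bar>f x - f y\<bar> \<le> L * \<bar>x - y\<bar>"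
  using field_differentiable_bound[of UNIV f f' L x y] assms by auto

lemma circle_map_lipschitz:
  assumes "\<bar>\<delta>\<bar> \<le> 3/4" shows "\<bar>circle_map \<delta> x - circle_map \<delta> y\<bar> \<le> 5 * \<bar>x - y\<bar>"
proof (rule real_lipschitz_if_deriv_bounded[OF has_real_derivative_circle_map])
  show "\<bar>circle_deriv \<delta> x\<bar> \<le> 5" for x
    using circle_deriv_bounds[OF assms, of x] by linarith
qed

lemma circle_deriv_lipschitz:
  assumes "\<bar>\<delta>\<bar> \<le> 3/4" shows "\<bar>circle_deriv \<delta> x - circle_deriv \<delta> y\<bar> \<le> 20 * pi * \<bar>x - y\<bar>"
proof (rule real_lipschitz_if_deriv_bounded)
  let ?s = "\<lambda>c x. sin (c * pi * x)" and ?c = "\<lambda>c x. cos (c * pi * x)"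
  fix x
  show "(circle_deriv \<delta> has_real_derivative
          ((- 6 * pi) * (?s 6 x * (1 + \<delta> * ?s 2 x)) + 2 * pi * (\<delta> * (?c 6 x * ?c 2 x))
            + (2 * pi * \<delta>) * (?c 6 x * ?c 2 x) + (2/3 * pi) * (- \<delta> * (?s 6 x * ?s 2 x)))) (at x)"
    unfolding circle_deriv_def[abs_def]
    by (auto intro!: derivative_eq_intros simp: field_simps)
  have "\<bar>\<delta> * ?s 2 x\<bar> \<le> 3/4 * 1" 
    by (intro abs_mult_le assms abs_sin_le_one)
  then have "\<bar>1 + \<delta> * ?s 2 x\<bar> \<le> 7/4" by linarith
  then have "\<bar>(- 6 * pi) * (?s 6 x * (1 + \<delta> * ?s 2 x))\<bar> \<le> (6 * pi) * (1 * (7/4))"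
    by (intro abs_mult_le abs_sin_le_one) auto
  moreover have "\<bar>(2 * pi) * (\<delta> * (?c 6 x * ?c 2 x))\<bar> \<le> (2 * pi) * (3/4 * (1 * 1))"
    by (intro abs_mult_le abs_cos_le_one assms) auto
  moreover have "\<bar>(2 * pi * \<delta>) * (?c 6 x * ?c 2 x)\<bar> \<le> (2 * pi * (3/4)) * (1 * 1)"
    by (intro abs_mult_le abs_cos_le_one assms) auto
  moreover have "\<bar>(2/3 * pi) * (- \<delta> * (?s 6 x * ?s 2 x))\<bar> \<le> (2/3 * pi) * (3/4 * (1 * 1))"
    by (intro abs_mult_le abs_sin_le_one) (use assms in auto)
  \<comment> \<open>The four bounds add up to \<open>14 * pi\<close>.\<close>
  ultimately show "\<bar>(- 6 * pi) * (?s 6 x * (1 + \<delta> * ?s 2 x)) + 2 * pi * (\<delta> * (?c 6 x * ?c 2 x))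
            + (2 * pi * \<delta>) * (?c 6 x * ?c 2 x) + (2/3 * pi) * (- \<delta> * (?s 6 x * ?s 2 x))\<bar> \<le> 20 * pi"
    using pi_gt_zero by linarith
qed

lemma circle_map_strict_mono:
  assumes "\<bar>\<delta>\<bar> \<le> 3/4" "x < y" shows "circle_map \<delta> x < circle_map \<delta> y"
proof (rule DERIV_pos_imp_increasing[OF assms(2)])
  fix z
  have "0 < circle_deriv \<delta> z" using circle_deriv_bounds(1)[OF assms(1), of z] by simp
  then show "\<exists>d. (circle_map \<delta> has_real_derivative d) (at z) \<and> 0 < d"
    using has_real_derivative_circle_map by blast
qed

lemma circle_map_third: "j \<in> \<int> \<Longrightarrow> circle_map \<delta> (j / 3) = j"
  using sin_cos_int_period(1)[of j 0] by (simp add: circle_map_def mult.assoc)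

text \<open>An integer \<open>j\<close> is the value at \<open>j / 3\<close> and, by strict
  monotonicity, at no other point.\<close>

lemma circle_map_int_iff:
  assumes "\<bar>\<delta>\<bar> \<le> 3/4" shows "circle_map \<delta> x \<in> \<int> \<longleftrightarrow> 3 * x \<in> \<int>"
proof
  assume "circle_map \<delta> x \<in> \<int>"
  then have "circle_map \<delta> (circle_map \<delta> x / 3) = circle_map \<delta> x" by (rule circle_map_third)
  then have "circle_map \<delta> x / 3 = x"
    using circle_map_strict_mono[OF assms] by (metis less_irrefl linorder_neqE_linordered_idom)
  then show "3 * x \<in> \<int>" using \<open>circle_map \<delta> x \<in> \<int>\<close> by (metis mult.commute nonzero_eq_divide_eq zero_neq_numeral)
next
  assume "3 * x \<in> \<int>" then show "circle_map \<delta> x \<in> \<int>" using circle_map_third[of "3 * x" \<delta>] by simp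
qed

section \<open>Perturbed cat maps\<close>

definition cat_lift :: "real \<Rightarrow> real \<Rightarrow> real^2 \<Rightarrow> real^2" where
  "cat_lift \<delta> \<epsilon> v = vector [v $ 1 + circle_map \<epsilon> (v $ 2 + circle_map \<delta> (v $ 1)), v $ 2 + circle_map \<delta> (v $ 1)]"

definition cat_inv_lift :: "real \<Rightarrow> real \<Rightarrow> real^2 \<Rightarrow> real^2" where
  "cat_inv_lift \<delta> \<epsilon> v = vector [v $ 1 - circle_map \<epsilon> (v $ 2), v $ 2 - circle_map \<delta> (v $ 1 - circle_map \<epsilon> (v $ 2))]"

abbreviation "cat_map \<delta> \<epsilon> \<equiv> torus_map (cat_lift \<delta> \<epsilon>)"
abbreviation "cat_inv_map \<delta> \<epsilon> \<equiv> torus_map (cat_inv_lift \<delta> \<epsilon>)"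

lemma cat_lift_inverse:
  "cat_inv_lift \<delta> \<epsilon> (cat_lift \<delta> \<epsilon> v) = v" "cat_lift \<delta> \<epsilon> (cat_inv_lift \<delta> \<epsilon> v) = v"
  by (simp_all add: cat_lift_def cat_inv_lift_def vec2_eq_iff)

text \<open>The linear part has rows \<open>(10, 3)\<close> and \<open>(3, 1)\<close> whatever the
  parameters. This makes all these maps homotopic, and it governs the action on the lattice in
  \<open>cat_maps_not_C1_conjugate\<close>.\<close>

lemma cat_lift_shift:
  assumes "\<forall>i. n $ i \<in> \<int>"
  shows "cat_lift \<delta> \<epsilon> (x + n) = cat_lift \<delta> \<epsilon> x + vector [10 * n $ 1 + 3 * n $ 2, 3 * n $ 1 + n $ 2]"
proof -
  have n: "n $ 1 \<in> \<int>" "n $ 2 + 3 * n $ 1 \<in> \<int>" using assms by auto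
  have "x $ 2 + n $ 2 + circle_map \<delta> (x $ 1 + n $ 1) = x $ 2 + circle_map \<delta> (x $ 1) + (n $ 2 + 3 * n $ 1)"
    by (simp add: circle_map_shift[OF n(1)])
  then have "circle_map \<epsilon> (x $ 2 + n $ 2 + circle_map \<delta> (x $ 1 + n $ 1))
      = circle_map \<epsilon> (x $ 2 + circle_map \<delta> (x $ 1)) + 3 * (n $ 2 + 3 * n $ 1)"
    by (simp only: circle_map_shift[OF n(2)])
  then show ?thesis
    using circle_map_shift[OF n(1)] by (simp add: cat_lift_def vec2_eq_iff)
qed

lemma cat_inv_lift_shift:
  assumes "\<forall>i. n $ i \<in> \<int>"
  shows "cat_inv_lift \<delta> \<epsilon> (x + n) = cat_inv_lift \<delta> \<epsilon> x + vector [n $ 1 - 3 * n $ 2, 10 * n $ 2 - 3 * n $ 1]"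
proof -
  have n: "n $ 2 \<in> \<int>" "n $ 1 - 3 * n $ 2 \<in> \<int>" using assms by auto
  have "x $ 1 + n $ 1 - circle_map \<epsilon> (x $ 2 + n $ 2) = x $ 1 - circle_map \<epsilon> (x $ 2) + (n $ 1 - 3 * n $ 2)"
    by (simp add: circle_map_shift[OF n(1)])
  then have "circle_map \<delta> (x $ 1 + n $ 1 - circle_map \<epsilon> (x $ 2 + n $ 2))
      = circle_map \<delta> (x $ 1 - circle_map \<epsilon> (x $ 2)) + 3 * (n $ 1 - 3 * n $ 2)"
    by (simp only: circle_map_shift[OF n(2)])
  then show ?thesis
    using circle_map_shift[OF n(1)] by (simp add: cat_inv_lift_def vec2_eq_iff)
qed

lemma cat_respects_lattice: "respects_lattice (cat_lift \<delta> \<epsilon>)" "respects_lattice (cat_inv_lift \<delta> \<epsilon>)"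
  unfolding respects_lattice_def
  by (simp_all add: cat_lift_shift cat_inv_lift_shift forall_2 torus_proj_shift)

lemmas cat_map_proj = cat_respects_lattice(1)[THEN torus_map_proj]
  and cat_inv_map_proj = cat_respects_lattice(2)[THEN torus_map_proj]

lemma cat_map_inverse:
  "cat_inv_map \<delta> \<epsilon> (cat_map \<delta> \<epsilon> p) = p" "cat_map \<delta> \<epsilon> (cat_inv_map \<delta> \<epsilon> p) = p"
  using torus_proj_surj[of p] by (auto simp: cat_map_proj cat_inv_map_proj cat_lift_inverse)

lemma bij_cat_map: "bij (cat_map \<delta> \<epsilon>)" and inv_cat_map: "inv (cat_map \<delta> \<epsilon>) = cat_inv_map \<delta> \<epsilon>"
proof -
  show "bij (cat_map \<delta> \<epsilon>)"
    by (rule o_bij[of "cat_inv_map \<delta> \<epsilon>"]) (simp_all add: fun_eq_iff cat_map_inverse)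
  show "inv (cat_map \<delta> \<epsilon>) = cat_inv_map \<delta> \<epsilon>"
    by (rule inv_unique_comp) (simp_all add: fun_eq_iff cat_map_inverse)
qed

section \<open>Derivatives of the cat maps\<close>

definition cat_fst_deriv :: "real \<Rightarrow> torus \<Rightarrow> real" where
  "cat_fst_deriv \<delta> p = circle_deriv \<delta> (rep_torus p $ 1)"

text \<open>The second shear is differentiated at the second coordinate reached after the first
  shear. It keeps that coordinate, which can therefore be read off from the image point.\<close>

definition cat_snd_deriv :: "real \<Rightarrow> real \<Rightarrow> torus \<Rightarrow> real" where
  "cat_snd_deriv \<delta> \<epsilon> p = circle_deriv \<epsilon> (rep_torus (cat_map \<delta> \<epsilon> p) $ 2)"

lemma circle_deriv_rep_torus:
  "circle_deriv \<delta> (rep_torus (torus_proj v) $ i) = circle_deriv \<delta> (v $ i)"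
proof -
  have "rep_torus (torus_proj v) $ i - v $ i \<in> \<int>"
    using torus_proj_eq_iff[of "rep_torus (torus_proj v)" v] by simp
  then show ?thesis
    using circle_deriv_shift[of "rep_torus (torus_proj v) $ i - v $ i" \<delta> "v $ i"] by simp
qed

lemma cat_deriv_proj:
  "cat_fst_deriv \<delta> (torus_proj v) = circle_deriv \<delta> (v $ 1)"
  "cat_snd_deriv \<delta> \<epsilon> (torus_proj v) = circle_deriv \<epsilon> (v $ 2 + circle_map \<delta> (v $ 1))"
  unfolding cat_fst_deriv_def cat_snd_deriv_def cat_map_proj circle_deriv_rep_torus
  by (simp_all add: cat_lift_def)

lemma cat_deriv_continuous:
  "continuous_on UNIV (cat_fst_deriv \<delta>)" "continuous_on UNIV (cat_snd_deriv \<delta> \<epsilon>)"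
  by (rule torus_continuousI, simp add: cat_deriv_proj, intro continuous_intros)+

definition cat_matrix :: "real \<Rightarrow> real \<Rightarrow> torus \<Rightarrow> real^2^2" where
  "cat_matrix \<delta> \<epsilon> p = (let a = cat_fst_deriv \<delta> p; b = cat_snd_deriv \<delta> \<epsilon> p in
     vector [vector [1 + a * b, b], vector [a, 1]])"

text \<open>The argument is the point before the forward map: this is the inverse of
  \<open>cat_matrix \<delta> \<epsilon> p\<close>, hence the derivative of the inverse map at the
  image of \<open>p\<close>.\<close>

definition cat_inv_matrix :: "real \<Rightarrow> real \<Rightarrow> torus \<Rightarrow> real^2^2" where
  "cat_inv_matrix \<delta> \<epsilon> p = (let a = cat_fst_deriv \<delta> p; b = cat_snd_deriv \<delta> \<epsilon> p in
     vector [vector [1, - b], vector [- a, 1 + a * b]])"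

lemma cat_lift_continuous: "continuous_on UNIV (cat_lift \<delta> \<epsilon>)" "continuous_on UNIV (cat_inv_lift \<delta> \<epsilon>)"
  unfolding cat_lift_def cat_inv_lift_def by (intro continuous_intros)+

lemma has_derivative_vec_nth [derivative_intros]:
  "(f has_derivative f') F \<Longrightarrow> ((\<lambda>x. f x $ i) has_derivative (\<lambda>h. f' h $ i)) F"
  by (rule bounded_linear.has_derivative[OF bounded_linear_vec_nth])

lemma cat_lift_has_derivative:
  "(cat_lift \<delta> \<epsilon> has_derivative (\<lambda>h. cat_matrix \<delta> \<epsilon> (torus_proj v) *v h)) (at v within S)"
  unfolding cat_lift_def[abs_def] cat_matrix_def Let_def matrix_vector_mult_2 cat_deriv_proj
  by (auto intro!: derivative_eq_intros simp: algebra_simps)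

lemma cat_inv_lift_has_derivative:
  "(cat_inv_lift \<delta> \<epsilon> has_derivative (\<lambda>h. cat_inv_matrix \<delta> \<epsilon> (torus_proj v) *v h)) (at (cat_lift \<delta> \<epsilon> v))"
  unfolding cat_inv_lift_def[abs_def] cat_inv_matrix_def Let_def matrix_vector_mult_2 cat_deriv_proj
  by (auto intro!: derivative_eq_intros simp: algebra_simps cat_lift_def)

lemma cat_has_torus_deriv: "has_torus_deriv (cat_map \<delta> \<epsilon>) (cat_matrix \<delta> \<epsilon> p) p"
proof -
  obtain v where v: "torus_proj v = p" using torus_proj_surj by blast
  show ?thesis
    unfolding has_torus_deriv_def v[symmetric]
    using torus_lift_map[OF cat_respects_lattice(1) cat_lift_continuous(1)]
      cat_lift_has_derivative by blast
qed

lemma cat_inv_has_torus_deriv: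
  "has_torus_deriv (cat_inv_map \<delta> \<epsilon>) (cat_inv_matrix \<delta> \<epsilon> (cat_inv_map \<delta> \<epsilon> p)) p"
proof -
  obtain v where v: "torus_proj v = cat_inv_map \<delta> \<epsilon> p" using torus_proj_surj by blast
  have "torus_proj (cat_lift \<delta> \<epsilon> v) = p"
    unfolding cat_map_proj[symmetric] v by (rule cat_map_inverse)
  then show ?thesis
    unfolding has_torus_deriv_def v[symmetric]
    using torus_lift_map[OF cat_respects_lattice(2) cat_lift_continuous(2)]
      cat_inv_lift_has_derivative cat_map_proj by blast
qed

lemma cat_map_continuous: "continuous_on UNIV (cat_map \<delta> \<epsilon>)" "continuous_on UNIV (cat_inv_map \<delta> \<epsilon>)"
  by (rule torus_continuousI, simp add: cat_map_proj cat_inv_map_proj,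
      rule continuous_on_compose2[OF continuous_torus_proj], rule cat_lift_continuous, simp)+

lemma torus_diffeo_cat_map: "torus_diffeo (cat_map \<delta> \<epsilon>)"
  unfolding torus_diffeo_def inv_cat_map
proof (intro conjI bij_cat_map)
  have "continuous_on UNIV (cat_matrix \<delta> \<epsilon>)" and inv: "continuous_on UNIV (cat_inv_matrix \<delta> \<epsilon>)"
    unfolding cat_matrix_def cat_inv_matrix_def Let_def
    by (intro continuous_intros cat_deriv_continuous)+
  then show "torus_C1 (cat_map \<delta> \<epsilon>)" by (intro torus_C1I(1)[OF cat_has_torus_deriv])
  have "continuous_on UNIV (\<lambda>p. cat_inv_matrix \<delta> \<epsilon> (cat_inv_map \<delta> \<epsilon> p))"
    by (rule continuous_on_compose2[OF inv]) (auto simp: cat_map_continuous)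
  then show "torus_C1 (cat_inv_map \<delta> \<epsilon>)" by (intro torus_C1I(1)[OF cat_inv_has_torus_deriv])
qed

context
  fixes \<delta> \<epsilon> :: real
  assumes small: "\<bar>\<delta>\<bar> \<le> 3/4" "\<bar>\<epsilon>\<bar> \<le> 3/4"
begin

lemma cat_deriv_bounds:
  "1 \<le> cat_fst_deriv \<delta> p" "cat_fst_deriv \<delta> p \<le> 5"
  "1 \<le> cat_snd_deriv \<delta> \<epsilon> p" "cat_snd_deriv \<delta> \<epsilon> p \<le> 5"
  using circle_deriv_bounds small by (auto simp: cat_fst_deriv_def cat_snd_deriv_def)

lemma torus_C1H_cat_map: "torus_C1H (cat_map \<delta> \<epsilon>)"
proof -
  have "norm (cat_matrix \<delta> \<epsilon> (torus_proj v) - cat_matrix \<delta> \<epsilon> (torus_proj w)) \<le> 1000 * pi * dist v w" for v w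
  proof -
    define a a' b b' d where "a = cat_fst_deriv \<delta> (torus_proj v)" and "a' = cat_fst_deriv \<delta> (torus_proj w)"
      and "b = cat_snd_deriv \<delta> \<epsilon> (torus_proj v)" and "b' = cat_snd_deriv \<delta> \<epsilon> (torus_proj w)"
      and "d = dist v w"
    note defs = a_def a'_def b_def b'_def
    have d: "\<bar>v $ 1 - w $ 1\<bar> \<le> d" "\<bar>v $ 2 - w $ 2\<bar> \<le> d" "0 \<le> d"
      using component_le_norm_cart[of "v - w"] by (auto simp: d_def dist_norm)
    have "\<bar>a - a'\<bar> \<le> 20 * pi * \<bar>v $ 1 - w $ 1\<bar>"
      unfolding defs cat_deriv_proj by (rule circle_deriv_lipschitz[OF small(1)])
    also have "\<dots> \<le> 20 * pi * d" using d by (intro mult_left_mono) auto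
    finally have 1: "\<bar>a - a'\<bar> \<le> 20 * pi * d" .
    have "\<bar>b - b'\<bar> \<le> 20 * pi * \<bar>(v $ 2 + circle_map \<delta> (v $ 1)) - (w $ 2 + circle_map \<delta> (w $ 1))\<bar>"
      unfolding defs cat_deriv_proj by (rule circle_deriv_lipschitz[OF small(2)])
    \<comment> \<open>The factor 6 is 1 for the direct dependence on the second coordinate plus 5,
      the Lipschitz constant of \<open>circle_map\<close>.\<close>
    also have "\<dots> \<le> 20 * pi * (6 * d)"
    proof (rule mult_left_mono)
      show "\<bar>(v $ 2 + circle_map \<delta> (v $ 1)) - (w $ 2 + circle_map \<delta> (w $ 1))\<bar> \<le> 6 * d"
      proof -
        have "\<bar>circle_map \<delta> (v $ 1) - circle_map \<delta> (w $ 1)\<bar> \<le> 5 * d"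
          using circle_map_lipschitz[OF small(1), of "v $ 1" "w $ 1"] d(1) by simp
        then show ?thesis
          unfolding add_diff_add using order_trans[OF abs_triangle_ineq add_mono[OF d(2)]] by fastforce
      qed
    qed simp
    finally have 2: "\<bar>b - b'\<bar> \<le> 120 * (pi * d)" by simp
    have "a * b - a' * b' = a * (b - b') + b' * (a - a')" by (simp add: algebra_simps)
    moreover have "\<bar>a * (b - b')\<bar> \<le> 5 * (120 * (pi * d))" "\<bar>b' * (a - a')\<bar> \<le> 5 * (20 * pi * d)"
    proof -
      have "\<bar>a\<bar> \<le> 5" "\<bar>b'\<bar> \<le> 5"
        using cat_deriv_bounds[of "torus_proj v"] cat_deriv_bounds[of "torus_proj w"] by (auto simp: defs)
      then show "\<bar>a * (b - b')\<bar> \<le> 5 * (120 * (pi * d))" "\<bar>b' * (a - a')\<bar> \<le> 5 * (20 * pi * d)"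
        using 1 2 by (simp_all only: abs_mult_le)
    qed
    ultimately have 3: "\<bar>a * b - a' * b'\<bar> \<le> 700 * (pi * d)" by linarith
    have "cat_matrix \<delta> \<epsilon> (torus_proj v) - cat_matrix \<delta> \<epsilon> (torus_proj w)
        = vector [vector [a * b - a' * b', b - b'], vector [a - a', 0]]"
      by (simp add: cat_matrix_def Let_def vec2_eq_iff defs)
    then have "norm (cat_matrix \<delta> \<epsilon> (torus_proj v) - cat_matrix \<delta> \<epsilon> (torus_proj w))
        \<le> \<bar>a * b - a' * b'\<bar> + \<bar>b - b'\<bar> + \<bar>a - a'\<bar> + \<bar>0\<bar>"
      by (simp only: norm_mat2_le)
    \<comment> \<open>The three entries contribute \<open>700 + 120 + 20 = 840\<close>, rounded up
      to 1000.\<close>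
    also have "\<dots> \<le> 1000 * (pi * d)" using 1 2 3 d(3) pi_gt_zero by simp
    finally show ?thesis by (simp add: d_def)
  qed
  then have "norm (cat_matrix \<delta> \<epsilon> p - cat_matrix \<delta> \<epsilon> q) \<le> (2 * (1000 * pi)) * dist p q powr (1/2)" for p q
    by (rule torus_lipschitz_imp_holder) simp
  moreover have "torus_deriv (cat_map \<delta> \<epsilon>) = cat_matrix \<delta> \<epsilon>"
    using torus_deriv_eq[OF cat_has_torus_deriv] by blast
  moreover have "torus_C1 (cat_map \<delta> \<epsilon>)" using torus_diffeo_cat_map by (simp add: torus_diffeo_def)
  ultimately have "torus_C1_alpha (1/2) (cat_map \<delta> \<epsilon>)" unfolding torus_C1_alpha_def by auto
  then show ?thesis unfolding torus_C1H_def by (intro exI[of _ "1/2"]) auto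
qed

text \<open>The expanding slope at a point is determined by data at its preimage, so it is a fixed
  point along the inverse map. The inverse matrix acts on contracting slopes by the same formula
  with \<open>a\<close> and \<open>b\<close> exchanged.\<close>

lemma cat_slope_system_exists:
  obtains s \<sigma> where "slope_system (cat_map \<delta> \<epsilon>) (cat_fst_deriv \<delta>) (cat_snd_deriv \<delta> \<epsilon>) s \<sigma>"
proof -
  let ?T = "cat_map \<delta> \<epsilon>" and ?T' = "cat_inv_map \<delta> \<epsilon>" and ?a = "cat_fst_deriv \<delta>" and ?b = "cat_snd_deriv \<delta> \<epsilon>"
  have "continuous_on UNIV (\<lambda>p. ?a (?T' p))" "continuous_on UNIV (\<lambda>p. ?b (?T' p))"
    by (rule continuous_on_compose2[OF cat_deriv_continuous(1) cat_map_continuous(2)]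
        continuous_on_compose2[OF cat_deriv_continuous(2) cat_map_continuous(2)], simp)+
  then obtain s where s: "continuous_on UNIV s" "\<And>p. 0 \<le> s p" "\<And>p. s p \<le> 1"
    "\<And>p. s p = (?a (?T' p) + s (?T' p)) / (1 + ?b (?T' p) * (?a (?T' p) + s (?T' p)))"
    using invariant_slope_exists[of "\<lambda>p. ?a (?T' p)" "\<lambda>p. ?b (?T' p)" ?T'] cat_map_continuous cat_deriv_bounds
    by metis
  obtain \<sigma> where \<sigma>: "continuous_on UNIV \<sigma>" "\<And>p. 0 \<le> \<sigma> p" "\<And>p. \<sigma> p \<le> 1"
    "\<And>p. \<sigma> p = (?b p + \<sigma> (?T p)) / (1 + ?a p * (?b p + \<sigma> (?T p)))"
    using invariant_slope_exists[of ?b ?a ?T] cat_map_continuous cat_deriv_continuous cat_deriv_bounds by metis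
  have "slope_system ?T ?a ?b s \<sigma>"
  proof
    show "has_torus_deriv ?T (vector [vector [1 + ?a p * ?b p, ?b p], vector [?a p, 1]]) p" for p
      using cat_has_torus_deriv[of \<delta> \<epsilon> p] by (simp add: cat_matrix_def Let_def)
    show "s (?T p) = (?a p + s p) / (1 + ?b p * (?a p + s p))" for p
      using s(4)[of "?T p"] by (simp add: cat_map_inverse)
    show "\<sigma> p = (?b p + \<sigma> (?T p)) / (1 + ?a p * (?b p + \<sigma> (?T p)))" for p
      by (rule \<sigma>(4))
  qed (use s(1-3) \<sigma>(1-3) cat_deriv_bounds torus_diffeo_cat_map in auto)
  then show thesis by (rule that)
qed

end

section \<open>Lebesgue measure\<close>

definition unit_square :: "(real^2) set" where
  "unit_square = {x. \<forall>i. 0 \<le> x $ i \<and> x $ i < 1}"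

lemma unit_square_iff: "x \<in> unit_square \<longleftrightarrow> 0 \<le> x $ 1 \<and> x $ 1 < 1 \<and> 0 \<le> x $ 2 \<and> x $ 2 < 1"
  by (auto simp: unit_square_def forall_2)

lemma unit_square_borel [measurable]: "unit_square \<in> sets borel"
proof -
  have "unit_square = {x \<in> space borel. 0 \<le> x $ 1 \<and> x $ 1 < 1 \<and> 0 \<le> x $ 2 \<and> x $ 2 < 1}"
    by (auto simp: unit_square_iff)
  also have "\<dots> \<in> sets borel" by measurable
  finally show ?thesis .
qed

lemma bounded_unit_square: "bounded unit_square"
proof (rule boundedI)
  fix x assume "x \<in> unit_square"
  then show "norm x \<le> 2" using norm_vec2_le[of x] by (simp add: unit_square_iff)
qed

lemma unit_square_eqI:
  assumes "x \<in> unit_square" "y \<in> unit_square" "torus_proj x = torus_proj y"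
  shows "x = y"
proof -
  have "x $ i = y $ i" for i
  proof -
    have "x $ i - y $ i \<in> \<int>" using assms(3) by (simp add: torus_proj_eq_iff)
    moreover have "\<bar>x $ i - y $ i\<bar> < 1" using assms(1,2) unfolding unit_square_def by (simp add: abs_less_iff) (smt (verit))
    ultimately show ?thesis using Ints_nonzero_abs_less1 by force
  qed
  then show ?thesis by (simp add: vec_eq_iff)
qed

definition lattice_point :: "int \<times> int \<Rightarrow> real^2" where
  "lattice_point k = vector [of_int (fst k), of_int (snd k)]"

lemma torus_proj_lattice_point: "torus_proj (lattice_point k + x) = torus_proj x"
  by (simp add: torus_proj_eq_iff lattice_point_def forall_2)

lemma lattice_point_inj: "lattice_point k = lattice_point l \<Longrightarrow> k = l"
  by (auto simp: lattice_point_def vec2_eq_iff prod_eq_iff)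

lemma torus_proj_eqE:
  assumes "torus_proj x = torus_proj y" obtains k where "y = lattice_point k + x"
proof -
  have "y $ 1 - x $ 1 \<in> \<int>" "y $ 2 - x $ 2 \<in> \<int>"
    using assms[symmetric] by (simp_all add: torus_proj_eq_iff)
  then obtain i j where "y $ 1 - x $ 1 = of_int i" "y $ 2 - x $ 2 = of_int j"
    by (auto elim!: Ints_cases)
  then have "y = lattice_point (i, j) + x" by (simp add: lattice_point_def vec2_eq_iff algebra_simps)
  then show thesis by (rule that)
qed

lemma unit_square_translate: "\<exists>k. lattice_point k + x \<in> unit_square"
proof
  show "lattice_point (- \<lfloor>x $ 1\<rfloor>, - \<lfloor>x $ 2\<rfloor>) + x \<in> unit_square"
    unfolding unit_square_iff lattice_point_def by simp linarith
qed

lemma emeasure_torus_lebesgue: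
  assumes "U \<in> sets borel"
  shows "emeasure torus_lebesgue U = emeasure lborel (torus_proj -` U \<inter> unit_square)"
proof -
  have [measurable]: "torus_proj \<in> borel_measurable borel"
    by (rule borel_measurable_continuous_onI[OF continuous_torus_proj])
  have "torus_proj \<in> restrict_space lborel unit_square \<rightarrow>\<^sub>M borel"
    by (intro measurable_restrict_space1) measurable
  then have "emeasure torus_lebesgue U = emeasure (restrict_space lborel unit_square)
      (torus_proj -` U \<inter> space (restrict_space lborel unit_square))"
    unfolding torus_lebesgue_def unit_square_def[symmetric] by (rule emeasure_distr[OF _ assms])
  also have "\<dots> = emeasure lborel (torus_proj -` U \<inter> unit_square)"
    by (subst emeasure_restrict_space) (auto simp: space_restrict_space)
  finally show ?thesis .
qed

text \<open>The image of the unit square under \<open>F\<close> is another fundamental domain of the lattice.\<close>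

lemma emeasure_lattice_periodic_image:
  assumes FG: "\<And>x. F (G x) = x" "\<And>x. G (F x) = x"
    and lattice: "respects_lattice F" "respects_lattice G"
    and G [measurable]: "G \<in> borel_measurable borel"
    and V [measurable]: "V \<in> sets borel" and periodic: "\<And>k x. lattice_point k + x \<in> V \<longleftrightarrow> x \<in> V"
  shows "emeasure lborel (V \<inter> G -` unit_square) = emeasure lborel (V \<inter> unit_square)"
proof -
  define W where "W = V \<inter> G -` unit_square"
  have [measurable]: "G -` unit_square \<in> sets borel" 
    using measurable_sets[OF G unit_square_borel] by simp
  then have W [measurable]: "W \<in> sets borel" unfolding W_def by measurable
  have trans [measurable]: "(+) c \<in> borel_measurable borel" "(\<lambda>x. x - c) \<in> borel_measurable borel" for c :: "real^2"
    by measurable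
  \<comment> \<open>\<open>X\<close> cuts \<open>W\<close> along the lattice translates of the unit
    square, and \<open>Y k\<close> is \<open>X k\<close> translated back. The sets
    \<open>Y k\<close> tile \<open>V \<inter> unit_square\<close> because the preimage of the unit
    square under \<open>G\<close> is a fundamental domain as well.\<close>
  define X where "X k = W \<inter> (\<lambda>x. x - lattice_point k) -` unit_square" for k
  define Y where "Y k = (+) (lattice_point k) -` W \<inter> unit_square" for k
  have meas: "X k \<in> sets borel" "Y k \<in> sets borel" for k
    unfolding X_def Y_def
    using measurable_sets[OF trans(1) W] measurable_sets[OF trans(2) unit_square_borel] by auto
  have dX: "disjoint_family X"
    unfolding disjoint_family_on_def
  proof (intro ballI impI equals0I)
    fix k l x assume "k \<noteq> l" "x \<in> X k \<inter> X l"
    moreover have "torus_proj (x - lattice_point k) = torus_proj (x - lattice_point l)"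
      using torus_proj_lattice_point[of k "x - lattice_point k"] 
        torus_proj_lattice_point[of l "x - lattice_point l"] by simp
    ultimately have "x - lattice_point k = x - lattice_point l"
      by (intro unit_square_eqI) (auto simp: X_def)
    with \<open>k \<noteq> l\<close> show False using lattice_point_inj by auto
  qed
  have dY: "disjoint_family Y"
    unfolding disjoint_family_on_def
  proof (intro ballI impI equals0I)
    fix k l x assume kl: "k \<noteq> l" "x \<in> Y k \<inter> Y l"
    have "torus_proj (G (lattice_point k + x)) = torus_proj (G (lattice_point l + x))"
      by (simp add: torus_map_proj[OF lattice(2), symmetric] torus_proj_lattice_point)
    then have "G (lattice_point k + x) = G (lattice_point l + x)"
      using kl by (intro unit_square_eqI) (auto simp: Y_def W_def)
    then have "lattice_point k + x = lattice_point l + x" using FG(1) by metis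
    with \<open>k \<noteq> l\<close> show False using lattice_point_inj by auto
  qed
  have UX: "(\<Union>k. X k) = W"
  proof (intro equalityI subsetI)
    fix x assume "x \<in> W"
    obtain k where k: "lattice_point k + x \<in> unit_square" using unit_square_translate by blast
    have "lattice_point (- fst k, - snd k) = - lattice_point k" by (simp add: lattice_point_def vec2_eq_iff)
    then have "x - lattice_point (- fst k, - snd k) \<in> unit_square" using k by (simp add: add.commute)
    then show "x \<in> (\<Union>k. X k)" using \<open>x \<in> W\<close> by (auto simp: X_def)
  qed (auto simp: X_def)
  have UY: "(\<Union>k. Y k) = V \<inter> unit_square"
  proof (intro equalityI subsetI)
    fix x assume x: "x \<in> V \<inter> unit_square"
    obtain k where k: "lattice_point k + G x \<in> unit_square" using unit_square_translate by blast
    \<comment> \<open>Applying \<open>F\<close> to the translate of \<open>G x\<close> in the unit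
      square gives a point over the same point of the torus as \<open>x\<close>, hence a lattice
      translate of \<open>x\<close>.\<close>
    have "torus_proj x = torus_proj (F (lattice_point k + G x))"
      by (simp add: torus_map_proj[OF lattice(1), symmetric] torus_proj_lattice_point)
        (simp add: torus_map_proj[OF lattice(1)] FG)
    then obtain l where l: "F (lattice_point k + G x) = lattice_point l + x" by (rule torus_proj_eqE)
    then have "G (lattice_point l + x) \<in> unit_square" using k FG(2) by metis
    then have "x \<in> Y l" using x periodic by (simp add: Y_def W_def)
    then show "x \<in> (\<Union>k. Y k)" by blast
  qed (auto simp: Y_def W_def periodic)
  have "emeasure lborel (X k) = emeasure lborel (Y k)" for k
  proof -
    have "emeasure lborel (X k) = emeasure (distr lborel borel ((+) (lattice_point k))) (X k)"
      by (simp add: lborel_distr_plus)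
    also have "\<dots> = emeasure lborel ((+) (lattice_point k) -` X k \<inter> space lborel)"
      using meas by (intro emeasure_distr) auto
    also have "(+) (lattice_point k) -` X k \<inter> space lborel = Y k" by (auto simp: X_def Y_def)
    finally show ?thesis .
  qed
  then have "emeasure lborel (\<Union>k. X k) = emeasure lborel (\<Union>k. Y k)"
    using meas dX dY by (subst (1 2) emeasure_UN_countable) auto
  then show ?thesis by (simp add: UX UY W_def)
qed

text \<open>Change of variables with Jacobian determinant 1. The formula is stated for
  \<open>lebesgue\<close> and transfers to \<open>lborel\<close> because \<open>S\<close> and its
  image are Borel.\<close>

lemma emeasure_image_unimodular:
  fixes F :: "real^2 \<Rightarrow> real^2"
  assumes S: "S \<in> sets borel" "bounded S" and FS: "F ` S \<in> sets borel"
    and der: "\<And>x. (F has_derivative (\<lambda>h. D x *v h)) (at x)" and det: "\<And>x. det (D x) = 1" and inj: "inj F"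
  shows "emeasure lborel (F ` S) = emeasure lborel S"
proof -
  have S_leb: "S \<in> lmeasurable" using S by (intro bounded_set_imp_lmeasurable) auto
  have "((\<lambda>x. \<bar>det (matrix (\<lambda>h. D x *v h))\<bar>) has_integral measure lebesgue S) S"
    using S_leb by (simp add: det matrix_of_matrix_vector_mul lmeasure_integral lmeasurable_iff_integrable_on
        integrable_integral)
  then have FS_leb: "F ` S \<in> lmeasurable" "measure lebesgue (F ` S) = measure lebesgue S"
    using has_measure_differentiable_image[of S F "\<lambda>x h. D x *v h" "measure lebesgue S"] S der inj
    by (auto intro: has_derivative_at_withinI inj_on_subset)
  have "emeasure lebesgue (F ` S) = emeasure lebesgue S"
    using S_leb FS_leb by (simp add: emeasure_eq_measure2)
  then show ?thesis using S FS by simp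
qed

text \<open>The lift maps the part of the unit square over the preimage of a set onto the part of
  another fundamental domain over the set itself. The change of variables keeps the area, and
  \<open>emeasure_lattice_periodic_image\<close> leads back to the unit square.\<close>

lemma preserves_torus_lebesgue:
  fixes F :: "real^2 \<Rightarrow> real^2"
  assumes FG: "\<And>x. F (G x) = x" "\<And>x. G (F x) = x"
    and lattice: "respects_lattice F" "respects_lattice G"
    and cont: "continuous_on UNIV F" "continuous_on UNIV G"
    and der: "\<And>x. (F has_derivative (\<lambda>h. D x *v h)) (at x)" and det: "\<And>x. det (D x) = 1"
  shows "preserves_measure (torus_map F) torus_lebesgue"
proof -
  have [measurable]: "F \<in> borel_measurable borel" "G \<in> borel_measurable borel"
    using cont by (simp_all add: borel_measurable_continuous_onI)
  have [measurable]: "torus_proj \<in> borel_measurable borel"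
    by (rule borel_measurable_continuous_onI[OF continuous_torus_proj])
  have "continuous_on UNIV (torus_map F)"
    by (rule torus_continuousI, simp add: torus_map_proj lattice,
        rule continuous_on_compose2[OF continuous_torus_proj cont(1)], simp)
  then have T [measurable]: "torus_map F \<in> borel_measurable borel"
    by (rule borel_measurable_continuous_onI)
  have sets: "sets torus_lebesgue = sets borel" by (simp add: torus_lebesgue_def)
  have "inj F" using FG(2) by (metis injI)
  have "emeasure torus_lebesgue (torus_map F -` U) = emeasure torus_lebesgue U" if U: "U \<in> sets borel" for U
  proof -
    have TU: "torus_map F -` U \<in> sets borel" using measurable_sets[OF T U] by simp
    define V where "V = torus_proj -` U"
    have V [measurable]: "V \<in> sets borel" using measurable_sets[of torus_proj borel borel U] U by (simp add: V_def)
    define S where "S = F -` V \<inter> unit_square"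
    have S: "S \<in> sets borel" using measurable_sets[of F borel borel V] by (simp add: S_def)
    have "emeasure torus_lebesgue (torus_map F -` U) = emeasure lborel S"
      unfolding emeasure_torus_lebesgue[OF TU] S_def V_def
      by (simp add: vimage_def torus_map_proj lattice)
    also have img: "F ` S = V \<inter> G -` unit_square"
      unfolding S_def using FG by (auto intro: image_eqI[where x = "G x" for x])
    have "emeasure lborel S = emeasure lborel (V \<inter> G -` unit_square)"
      unfolding img[symmetric]
    proof (rule emeasure_image_unimodular[OF S _ _ der det \<open>inj F\<close>, symmetric])
      show "bounded S" using bounded_unit_square by (rule bounded_subset) (simp add: S_def)
      show "F ` S \<in> sets borel"
        unfolding img using measurable_sets[of G borel borel unit_square] by simp
    qed
    also have "\<dots> = emeasure lborel (V \<inter> unit_square)"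
      by (rule emeasure_lattice_periodic_image[OF FG lattice])
        (auto simp: V_def torus_proj_lattice_point V[unfolded V_def])
    also have "\<dots> = emeasure torus_lebesgue U"
      unfolding emeasure_torus_lebesgue[OF U] V_def ..
    finally show ?thesis .
  qed
  then have "distr torus_lebesgue torus_lebesgue (torus_map F) = torus_lebesgue"
    using T sets by (intro measure_eqI) (auto simp: emeasure_distr sets_eq_imp_space_eq[OF sets] measurable_cong_sets[OF sets sets])
  then show ?thesis
    using T sets by (simp add: preserves_measure_def measurable_cong_sets[OF sets sets])
qed

lemma cat_map_preserves_lebesgue: "preserves_measure (cat_map \<delta> \<epsilon>) torus_lebesgue"
  by (rule preserves_torus_lebesgue[where G = "cat_inv_lift \<delta> \<epsilon>", OF _ _ cat_respects_lattice
        cat_lift_continuous cat_lift_has_derivative])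
    (simp_all add: cat_lift_inverse cat_matrix_def Let_def det_2)

section \<open>Homotopy\<close>

text \<open>The straight-line homotopy between the lifts descends to the torus: both lifts move by
  the same lattice vector \<open>m\<close>, and so do their convex combinations.\<close>

lemma homotopic_torus_maps:
  fixes F G :: "real^2 \<Rightarrow> real^2"
  assumes cont: "continuous_on UNIV F" "continuous_on UNIV G"
    and shift: "\<And>x n. \<forall>i. n $ i \<in> \<int> \<Longrightarrow>
      \<exists>m. (\<forall>i. m $ i \<in> \<int>) \<and> F (x + n) = F x + m \<and> G (x + n) = G x + m"
  shows "homotopic_with_canon (\<lambda>_. True) UNIV UNIV (torus_map F) (torus_map G)"
proof -
  define H where "H t x = (1 - t) *\<^sub>R F x + t *\<^sub>R G x" for t x
  have H_shift: "torus_proj (H t (x + n)) = torus_proj (H t x)" if n: "\<forall>i. n $ i \<in> \<int>" for t x n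
  proof -
    obtain m where m: "\<forall>i. m $ i \<in> \<int>" "F (x + n) = F x + m" "G (x + n) = G x + m"
      using shift[OF n] by blast
    have "H t (x + n) = H t x + m" unfolding H_def m(2,3) by (simp add: algebra_simps)
    then show ?thesis using torus_proj_shift[OF m(1)] by simp
  qed
  have "respects_lattice (H t)" for t using H_shift by (simp add: respects_lattice_def)
  note H_proj = torus_map_proj[OF this]
  define h where "h = (\<lambda>(t :: real, p). torus_map (H t) p)"
  have "continuous_on ({0..1} \<times> UNIV) h"
  proof (rule torus_continuous_pairI)
    have "continuous_on ({0..1} \<times> UNIV) (\<lambda>z. H (fst z) (snd z))"
      unfolding H_def
      by (intro continuous_intros continuous_on_compose2[OF cont(1)] continuous_on_compose2[OF cont(2)]) auto
    then show "continuous_on ({0..1} \<times> UNIV) (\<lambda>(t, x). torus_proj (H t x))"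
      unfolding case_prod_unfold by (rule continuous_on_compose2[OF continuous_torus_proj]) simp
    show "h (t, torus_proj x) = torus_proj (H t x)" for t x
      by (simp add: h_def H_proj)
  qed
  then have "continuous_map (prod_topology (top_of_set {0..1}) (top_of_set UNIV)) (top_of_set UNIV) h"
    by (subst prod_topology_subtopology_eu) simp
  moreover have "h (0, p) = torus_map F p" "h (1, p) = torus_map G p" for p
    by (simp_all add: h_def H_def torus_map_def)
  ultimately show ?thesis
    unfolding homotopic_with_def by (intro exI[of _ h]) blast
qed

lemma homotopic_cat_maps:
  "homotopic_with_canon (\<lambda>_. True) UNIV UNIV (cat_map \<delta> \<epsilon>) (cat_map \<delta>' \<epsilon>')"
proof (rule homotopic_torus_maps)
  fix x n :: "real^2" assume n: "\<forall>i. n $ i \<in> \<int>"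
  show "\<exists>m. (\<forall>i. m $ i \<in> \<int>) \<and> cat_lift \<delta> \<epsilon> (x + n) = cat_lift \<delta> \<epsilon> x + m
           \<and> cat_lift \<delta>' \<epsilon>' (x + n) = cat_lift \<delta>' \<epsilon>' x + m"
    using n by (intro exI[of _ "vector [10 * n $ 1 + 3 * n $ 2, 3 * n $ 1 + n $ 2]"])
      (simp add: cat_lift_shift[OF n] forall_2)
qed (rule cat_lift_continuous)+

section \<open>Smooth conjugacies and fixed points\<close>

text \<open>Differentiating \<open>h \<circ> T = S \<circ> h\<close> at the fixed point gives
  \<open>K ** D = E ** K\<close> with \<open>K\<close> invertible, so \<open>D\<close> and
  \<open>E\<close> are similar.\<close>

lemma C1_conjugacy_trace:
  assumes h: "torus_diffeo h" "h \<circ> T = S \<circ> h" and fixed: "T p = p"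
    and der: "has_torus_deriv T D p" "has_torus_deriv S E (h p)"
  shows "trace D = trace E"
proof -
  define K K' where "K = torus_deriv h p" and "K' = torus_deriv (inv h) (h p)"
  have K: "has_torus_deriv h K p" and K': "has_torus_deriv (inv h) K' (h p)"
    using h(1) by (auto simp: K_def K'_def torus_diffeo_def intro: has_torus_deriv_torus_deriv)
  have Sh: "S (h p) = h p" using h(2) fixed by (metis comp_apply)
  have "inv h \<circ> h = id" using h(1) by (simp add: torus_diffeo_def bij_is_inj)
  then have "has_torus_deriv id (K' ** K) p"
    using has_torus_deriv_compose[OF K K'] by simp
  then have K'K: "K' ** K = mat 1" using has_torus_deriv_id has_torus_deriv_unique by blast
  then have KK': "K ** K' = mat 1" by (simp add: matrix_left_right_inverse)
  have "has_torus_deriv (h \<circ> T) (K ** D) p" using has_torus_deriv_compose[OF der(1)] K fixed by simp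
  moreover have "has_torus_deriv (h \<circ> T) (E ** K) p"
    unfolding h(2) using has_torus_deriv_compose[OF K der(2)] .
  ultimately have "K ** D = E ** K" by (rule has_torus_deriv_unique)
  then have "E = K ** D ** K'" by (metis KK' matrix_mul_assoc matrix_mul_rid)
  then have "trace E = trace (K' ** (K ** D))" by (metis trace_mul_sym)
  then show ?thesis by (simp add: matrix_mul_assoc K'K)
qed

text \<open>A point is fixed if both shears move it by integers. The integer
  \<open>circle_map \<delta> (v $ 1)\<close> then drops out of the argument of the second shear by
  periodicity.\<close>

lemma cat_fixed_point_iff:
  assumes "\<bar>\<delta>\<bar> \<le> 3/4" "\<bar>\<epsilon>\<bar> \<le> 3/4"
  shows "cat_map \<delta> \<epsilon> (torus_proj v) = torus_proj v \<longleftrightarrow> 3 * v $ 1 \<in> \<int> \<and> 3 * v $ 2 \<in> \<int>"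
proof -
  have "cat_map \<delta> \<epsilon> (torus_proj v) = torus_proj v \<longleftrightarrow>
      circle_map \<epsilon> (v $ 2 + circle_map \<delta> (v $ 1)) \<in> \<int> \<and> circle_map \<delta> (v $ 1) \<in> \<int>"
    by (simp add: cat_map_proj torus_proj_eq_iff forall_2 cat_lift_def)
  also have "\<dots> \<longleftrightarrow> circle_map \<epsilon> (v $ 2) \<in> \<int> \<and> circle_map \<delta> (v $ 1) \<in> \<int>"
    by (auto simp: circle_map_shift)
  finally show ?thesis using assms by (auto simp: circle_map_int_iff)
qed

text \<open>The sign of \<open>sin (2 * pi * j / 3)\<close>.\<close>

definition third_sign :: "int \<Rightarrow> real" where
  "third_sign j = (if j mod 3 = 0 then 0 else if j mod 3 = 1 then 1 else - 1)"

lemma third_sign_cases: "third_sign j = 0 \<or> third_sign j = 1 \<or> third_sign j = - 1"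
  by (simp add: third_sign_def)

text \<open>At the thirds \<open>sin (6 * pi * x)\<close> is 0 and \<open>cos (6 * pi * x)\<close>
  is 1, so only the term \<open>\<delta> * sin (2 * pi * x)\<close> varies.\<close>

lemma circle_deriv_third: "circle_deriv \<delta> (of_int j / 3) = 4 + \<delta> * (sqrt 3 / 2) * third_sign j"
proof -
  have 1: "circle_deriv \<delta> (1/3) = 4 + \<delta> * (sqrt 3 / 2)" for \<delta>
  proof -
    have "sin (2 * pi * (1/3)) = sqrt 3 / 2" using sin_120' by (simp add: field_simps)
    moreover have "cos (6 * pi * (1/3)) = 1" "sin (6 * pi * (1/3)) = 0" by simp_all
    ultimately show ?thesis unfolding circle_deriv_def by simp
  qed
  \<comment> \<open>Up to an integer \<open>2/3\<close> is \<open>- (1/3)\<close>, and reflection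
    reverses the sign of \<open>\<delta>\<close>.\<close>
  have 2: "circle_deriv \<delta> (2/3) = 4 - \<delta> * (sqrt 3 / 2)"
    using circle_deriv_shift[of 1 \<delta> "- (1/3)"] by (simp add: circle_deriv_minus 1)
  have "j = j mod 3 + 3 * (j div 3)" by simp
  then have "(of_int j :: real) / 3 = (of_int (j mod 3) + 3 * of_int (j div 3)) / 3"
    by (metis of_int_add of_int_mult of_int_numeral)
  also have "\<dots> = of_int (j mod 3) / 3 + of_int (j div 3)" by simp
  finally have "circle_deriv \<delta> (of_int j / 3) = circle_deriv \<delta> (of_int (j mod 3) / 3 + of_int (j div 3))"
    by (rule arg_cong)
  then have j: "circle_deriv \<delta> (of_int j / 3) = circle_deriv \<delta> (of_int (j mod 3) / 3)"
    by (simp only: circle_deriv_shift Ints_of_int)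
  consider "j mod 3 = 0" | "j mod 3 = 1" | "j mod 3 = 2"
    using pos_mod_sign[of 3 j] pos_mod_bound[of 3 j] by linarith
  then show ?thesis
    using 1 2 unfolding j by cases (simp_all add: third_sign_def circle_deriv_def)
qed

lemma cat_trace_third:
  assumes "v $ 1 = of_int i / 3" "v $ 2 = of_int j / 3"
  shows "trace (cat_matrix \<delta> \<epsilon> (torus_proj v))
    = 2 + (4 + \<delta> * (sqrt 3 / 2) * third_sign i) * (4 + \<epsilon> * (sqrt 3 / 2) * third_sign j)"
proof -
  have "circle_deriv \<epsilon> (v $ 2 + circle_map \<delta> (v $ 1)) = circle_deriv \<epsilon> (of_int j / 3)"
    unfolding assms by (simp add: circle_map_third circle_deriv_shift)
  then show ?thesis
    by (simp add: cat_matrix_def Let_def trace_def sum_2 cat_deriv_proj assms circle_deriv_third)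
qed

text \<open>The left-hand sides are the traces of the second map at its fixed points, less 2. The
  right-hand sides are the corresponding values of the first map at \<open>(0, 0)\<close>,
  \<open>(1/3, 0)\<close> and \<open>(0, 1/3)\<close>.\<close>

lemma third_trace_cases:
  fixes s t :: real
  assumes "s = 0 \<or> s = 1 \<or> s = - 1" "t = 0 \<or> t = 1 \<or> t = - 1"
  shows "(4 + (- 1/2) * (sqrt 3 / 2) * s) * (4 + 3/4 * (sqrt 3 / 2) * t) = 16 \<Longrightarrow> s = 0 \<and> t = 0"
    and "(4 + (- 1/2) * (sqrt 3 / 2) * s) * (4 + 3/4 * (sqrt 3 / 2) * t) = 16 + 3 * (sqrt 3 / 2) \<Longrightarrow> s = 0 \<and> t = 1"
    and "(4 + (- 1/2) * (sqrt 3 / 2) * s) * (4 + 3/4 * (sqrt 3 / 2) * t) = 16 + 2 * (sqrt 3 / 2) \<Longrightarrow> s = - 1 \<and> t = 0"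
proof -
  define w where "w = sqrt 3 / 2"
  have w2: "w * w = 3/4" by (simp add: w_def)
  \<comment> \<open>Rational bounds fine enough to tell the three values from those at the other
    pairs of signs.\<close>
  have "17/10 < sqrt 3" "sqrt 3 < 9/5"
    by (rule real_less_rsqrt real_less_lsqrt; simp add: power2_eq_square)+
  then have w: "17/20 < w" "w < 9/10" by (simp_all add: w_def)
  have "(4 + (- 1/2) * w * s) * (4 + 3/4 * w * t) = 16 + w * (3 * t - 2 * s) - 3/8 * (w * w) * (s * t)"
    by (simp add: field_simps)
  then have expand: "(4 + (- 1/2) * w * s) * (4 + 3/4 * w * t) = 16 + w * (3 * t - 2 * s) - 9/32 * (s * t)"
    unfolding w2 by simp
  show "(4 + (- 1/2) * (sqrt 3 / 2) * s) * (4 + 3/4 * (sqrt 3 / 2) * t) = 16 \<Longrightarrow> s = 0 \<and> t = 0"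
    and "(4 + (- 1/2) * (sqrt 3 / 2) * s) * (4 + 3/4 * (sqrt 3 / 2) * t) = 16 + 3 * (sqrt 3 / 2) \<Longrightarrow> s = 0 \<and> t = 1"
    and "(4 + (- 1/2) * (sqrt 3 / 2) * s) * (4 + 3/4 * (sqrt 3 / 2) * t) = 16 + 2 * (sqrt 3 / 2) \<Longrightarrow> s = - 1 \<and> t = 0"
    unfolding w_def[symmetric] expand using assms w by auto
qed

text \<open>The traces force \<open>h\<close> to act on \<open>(0, 0)\<close>,
  \<open>(1/3, 0)\<close> and \<open>(0, 1/3)\<close> as the quarter turn. The contradiction lies in
  the integer matrix with columns \<open>H e1\<close> and \<open>H e2\<close>: compatibility with
  the linear part makes its off-diagonal entries equal, while the two other fixed points make them
  congruent to -1 and 1 modulo 3.\<close>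

lemma cat_maps_not_C1_conjugate: "\<not> C1_conjugate (cat_map (3/4) (1/2)) (cat_map (- 1/2) (3/4))"
proof
  let ?T = "cat_map (3/4) (1/2)" and ?S = "cat_map (- 1/2) (3/4)"
  let ?F = "cat_lift (3/4) (1/2)" and ?G = "cat_lift (- 1/2) (3/4)"
  assume "C1_conjugate ?T ?S"
  then obtain h where h: "torus_diffeo h" "h \<circ> ?T = ?S \<circ> h" by (auto simp: C1_conjugate_def)
  have fixed: "\<exists>k l. h (torus_proj v) = torus_proj (vector [of_int k / 3, of_int l / 3])
      \<and> (4 + 3/4 * (sqrt 3 / 2) * third_sign i) * (4 + 1/2 * (sqrt 3 / 2) * third_sign j)
        = (4 + (- 1/2) * (sqrt 3 / 2) * third_sign k) * (4 + 3/4 * (sqrt 3 / 2) * third_sign l)"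
    if v: "v $ 1 = of_int i / 3" "v $ 2 = of_int j / 3" for v i j
  proof -
    obtain x where x: "torus_proj x = h (torus_proj v)" using torus_proj_surj by blast
    have T: "?T (torus_proj v) = torus_proj v" by (subst cat_fixed_point_iff) (simp_all add: v)
    then have "?S (h (torus_proj v)) = h (torus_proj v)" using h(2) by (metis comp_apply)
    then have "3 * x $ 1 \<in> \<int>" "3 * x $ 2 \<in> \<int>"
      unfolding x[symmetric] by (simp_all add: cat_fixed_point_iff)
    then obtain k l where kl: "3 * x $ 1 = of_int k" "3 * x $ 2 = of_int l" by (auto elim!: Ints_cases)
    then have kl: "x $ 1 = of_int k / 3" "x $ 2 = of_int l / 3" by simp_all
    have "trace (cat_matrix (3/4) (1/2) (torus_proj v)) = trace (cat_matrix (- 1/2) (3/4) (torus_proj x))"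
      by (rule C1_conjugacy_trace[OF h T cat_has_torus_deriv]) (simp add: x cat_has_torus_deriv)
    then have "(4 + 3/4 * (sqrt 3 / 2) * third_sign i) * (4 + 1/2 * (sqrt 3 / 2) * third_sign j)
        = (4 + (- 1/2) * (sqrt 3 / 2) * third_sign k) * (4 + 3/4 * (sqrt 3 / 2) * third_sign l)"
      unfolding cat_trace_third[OF v] cat_trace_third[OF kl] by simp
    moreover have "h (torus_proj v) = torus_proj (vector [of_int k / 3, of_int l / 3])"
      unfolding x[symmetric] kl[symmetric] vector_2_eta ..
    ultimately show ?thesis by blast
  qed
  have mod3: "(of_int k :: real) / 3 \<in> \<int>" if "k mod 3 = 0" for k
    using that by (metis Ints_of_int mod_0_imp_dvd of_int_divide_in_Ints of_int_numeral)
  have mod3': "(of_int k :: real) / 3 - of_int l / 3 \<in> \<int>" if "k mod 3 = l mod 3" for k l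
    using mod3[of "k - l"] that by (simp add: mod_eq_dvd_iff diff_divide_distrib mod_eq_0_iff_dvd)
  have third_sign_D: "third_sign k = 0 \<Longrightarrow> k mod 3 = 0 mod 3" "third_sign k = 1 \<Longrightarrow> k mod 3 = 1 mod 3"
      "third_sign k = - 1 \<Longrightarrow> k mod 3 = (- 1) mod 3" for k
    by (auto simp: third_sign_def split: if_splits)
  have eqI: "h p = torus_proj (vector [of_int k / 3, of_int l / 3])
      \<Longrightarrow> k mod 3 = k' mod 3 \<Longrightarrow> l mod 3 = l' mod 3
      \<Longrightarrow> h p = torus_proj (vector [of_int k' / 3, of_int l' / 3])" for p k l k' l'
    by (simp add: torus_proj_eq_iff forall_2 mod3')
  have h0: "h (torus_proj 0) = torus_proj 0"
  proof -
    obtain k l where *: "h (torus_proj 0) = torus_proj (vector [of_int k / 3, of_int l / 3])"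
      "(4 + (- 1/2) * (sqrt 3 / 2) * third_sign k) * (4 + 3/4 * (sqrt 3 / 2) * third_sign l) = 16"
      using fixed[of 0 0 0] by (auto simp: third_sign_def)
    have "third_sign k = 0 \<and> third_sign l = 0"
      by (rule third_trace_cases(1)[OF third_sign_cases third_sign_cases *(2)])
    then have "h (torus_proj 0) = torus_proj (vector [of_int 0 / 3, of_int 0 / 3])"
      using third_sign_D by (intro eqI[OF *(1)]) auto
    moreover have "vector [of_int 0 / 3, of_int 0 / 3] = (0 :: real^2)" by (simp add: vec2_eq_iff)
    ultimately show ?thesis by simp
  qed
  have h1: "h (torus_proj (vector [1/3, 0])) = torus_proj (vector [0, 1/3])"
  proof -
    obtain k l where *: "h (torus_proj (vector [1/3, 0])) = torus_proj (vector [of_int k / 3, of_int l / 3])"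
      "(4 + (- 1/2) * (sqrt 3 / 2) * third_sign k) * (4 + 3/4 * (sqrt 3 / 2) * third_sign l) = 16 + 3 * (sqrt 3 / 2)"
      using fixed[of "vector [1/3, 0]" 1 0] by (auto simp: third_sign_def)
    have "third_sign k = 0 \<and> third_sign l = 1"
      by (rule third_trace_cases(2)[OF third_sign_cases third_sign_cases *(2)])
    then have "h (torus_proj (vector [1/3, 0])) = torus_proj (vector [of_int 0 / 3, of_int 1 / 3])"
      using third_sign_D by (intro eqI[OF *(1)]) auto
    then show ?thesis by simp
  qed
  have h2: "h (torus_proj (vector [0, 1/3])) = torus_proj (vector [- 1/3, 0])"
  proof -
    obtain k l where *: "h (torus_proj (vector [0, 1/3])) = torus_proj (vector [of_int k / 3, of_int l / 3])"
      "(4 + (- 1/2) * (sqrt 3 / 2) * third_sign k) * (4 + 3/4 * (sqrt 3 / 2) * third_sign l) = 16 + 2 * (sqrt 3 / 2)"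
      using fixed[of "vector [0, 1/3]" 0 1] by (auto simp: third_sign_def)
    have "third_sign k = - 1 \<and> third_sign l = 0"
      by (rule third_trace_cases(3)[OF third_sign_cases third_sign_cases *(2)])
    then have "h (torus_proj (vector [0, 1/3])) = torus_proj (vector [of_int (- 1) / 3, of_int 0 / 3])"
      using third_sign_D by (intro eqI[OF *(1)]) auto
    then show ?thesis by simp
  qed
  obtain H0 where H0: "torus_lift h H0"
    using h(1) unfolding torus_diffeo_def torus_C1_def has_torus_deriv_def by blast
  \<comment> \<open>As \<open>h\<close> fixes the origin of the torus, its lift can be normalised to
    vanish at 0.\<close>
  define H where "H x = H0 x - H0 0" for x
  have H_cont: "continuous_on UNIV H"
    unfolding H_def using H0 by (intro continuous_intros) (simp add: torus_lift_def)
  have H_proj: "torus_proj (H x) = h (torus_proj x)" for x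
  proof -
    have "torus_proj (H0 0) = torus_proj 0" using H0 h0 by (simp add: torus_lift_def)
    then have "torus_proj (H x) = torus_proj (H0 x)" by (simp add: torus_proj_eq_iff H_def Ints_minus)
    then show ?thesis using H0 by (simp add: torus_lift_def)
  qed
  have H_0: "H 0 = 0" by (simp add: H_def)
  \<comment> \<open>Shifting the argument by a lattice vector gives another lift of
    \<open>h\<close>, and two lifts differ by a constant.\<close>
  have H_add: "H (x + n) = H x + H n" if n: "\<forall>i. n $ i \<in> \<int>" for x n
  proof -
    have "H (x + n) - H (0 + n) = H x - H 0"
    proof (rule torus_lifts_diff_const[OF _ H_cont])
      show "continuous_on UNIV (\<lambda>x. H (x + n))"
        by (rule continuous_on_compose2[OF H_cont]) (auto intro: continuous_intros)
      show "torus_proj (H (x + n)) = torus_proj (H x)" for x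
        by (simp add: H_proj torus_proj_shift[OF n])
    qed
    then show ?thesis by (simp add: H_0 algebra_simps)
  qed
  have H_mult: "H (real k *\<^sub>R n) = real k *\<^sub>R H n" if n: "\<forall>i. n $ i \<in> \<int>" for k n
    by (induction k) (simp_all add: H_0 scaleR_add_left H_add[OF n] add.commute[of n])
  have H_int: "H n $ i \<in> \<int>" if n: "\<forall>i. n $ i \<in> \<int>" for n i
  proof -
    have "torus_proj (H n) = torus_proj 0"
      using torus_proj_shift[OF n, of 0] h0 by (simp add: H_proj)
    then show ?thesis by (simp add: torus_proj_eq_iff)
  qed
  have F_0: "?F 0 = 0" "?G 0 = 0" 
    using circle_map_third[of 0] by (simp_all add: cat_lift_def vec2_eq_iff)
  \<comment> \<open>Both sides lift the same map and vanish at 0.\<close>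
  have H_conj: "H (?F x) = ?G (H x)" for x
  proof -
    have "H (?F x) - H (?F 0) = ?G (H x) - ?G (H 0)"
    proof (rule torus_lifts_diff_const)
      show "continuous_on UNIV (\<lambda>x. H (?F x))" "continuous_on UNIV (\<lambda>x. ?G (H x))"
        by (rule continuous_on_compose2[OF H_cont cat_lift_continuous(1)]
            continuous_on_compose2[OF cat_lift_continuous(1) H_cont], simp)+
      show "torus_proj (H (?F x)) = torus_proj (?G (H x))" for x
        using fun_cong[OF h(2), of "torus_proj x"] by (simp add: H_proj cat_map_proj[symmetric])
    qed
    then show ?thesis by (simp only: F_0 H_0 diff_zero)
  qed
  define e1 e2 :: "real^2" where "e1 = vector [1, 0]" and "e2 = vector [0, 1]"
  have e_int: "\<forall>i. e1 $ i \<in> \<int>" "\<forall>i. e2 $ i \<in> \<int>" by (simp_all add: e1_def e2_def forall_2)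
  have H_comb: "H (x + (real k *\<^sub>R e1 + real l *\<^sub>R e2)) = H x + (real k *\<^sub>R H e1 + real l *\<^sub>R H e2)" for x k l
  proof -
    have 1: "\<forall>i. (real k *\<^sub>R e1) $ i \<in> \<int>" and 2: "\<forall>i. (real l *\<^sub>R e2) $ i \<in> \<int>" using e_int by simp_all
    show ?thesis
      using H_add[OF 1, of x] H_add[OF 2, of "x + real k *\<^sub>R e1"]
      by (simp add: H_mult e_int add.assoc)
  qed
  \<comment> \<open>The first coordinate of \<open>H (?F e1) = ?G (H e1)\<close>, in which both maps
    act on lattice points through their linear part.\<close>
  have "10 * H e1 $ 1 + 3 * H e2 $ 1 = 10 * H e1 $ 1 + 3 * H e1 $ 2"
  proof -
    have "?F (0 + e1) = 0 + (real 10 *\<^sub>R e1 + real 3 *\<^sub>R e2)"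
      unfolding cat_lift_shift[OF e_int(1)] F_0 by (simp add: vec2_eq_iff e1_def e2_def)
    moreover have "?G (0 + H e1) = vector [10 * H e1 $ 1 + 3 * H e1 $ 2, 3 * H e1 $ 1 + H e1 $ 2]"
      unfolding cat_lift_shift[OF allI[OF H_int[OF e_int(1)]]] F_0 by simp
    ultimately have "H (0 + (real 10 *\<^sub>R e1 + real 3 *\<^sub>R e2))
        = vector [10 * H e1 $ 1 + 3 * H e1 $ 2, 3 * H e1 $ 1 + H e1 $ 2]"
      using H_conj[of "0 + e1"] by simp
    then show ?thesis unfolding H_comb by (simp add: H_0 vec2_eq_iff)
  qed
  then have eq1: "H e2 $ 1 = H e1 $ 2" by simp
  have c1: "circle_map \<delta> (1/3) = 1" "circle_map \<delta> 0 = 0" "circle_map \<delta> (- (1/3)) = - 1" "circle_map \<delta> 1 = 3"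
      "circle_map \<delta> (- 1) = - 3" for \<delta>
    using circle_map_third[of 1 \<delta>] circle_map_third[of 0 \<delta>] circle_map_third[of "- 1" \<delta>]
      circle_map_third[of 3 \<delta>] circle_map_third[of "- 3" \<delta>] by simp_all
  \<comment> \<open>\<open>?F\<close> moves \<open>(1/3, 0)\<close> by the lattice vector
    \<open>(3, 1)\<close>, and \<open>?G\<close> moves \<open>(0, 1/3)\<close> by
    \<open>(1, 0)\<close>. The unknown lattice vector \<open>m\<close> enters through the linear
    part minus the identity, whose entries are divisible by 3. So \<open>H e2 $ 1\<close> is 1
    modulo 3.\<close>
  obtain a b where ab: "a \<in> \<int>" "b \<in> \<int>" "3 * H e1 $ 1 + H e2 $ 1 = 1 + 9 * a + 3 * b"
  proof -
    define m where "m = H (vector [1/3, 0]) - vector [0, 1/3]"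
    have m: "\<forall>i. m $ i \<in> \<int>"
      using h1 H_proj[of "vector [1/3, 0]"] by (simp add: m_def torus_proj_eq_iff)
    have "?F (vector [1/3, 0]) = vector [1/3, 0] + (real 3 *\<^sub>R e1 + real 1 *\<^sub>R e2)"
      by (simp add: cat_lift_def vec2_eq_iff e1_def e2_def c1)
    then have "H (vector [1/3, 0]) + (real 3 *\<^sub>R H e1 + real 1 *\<^sub>R H e2) = ?G (vector [0, 1/3] + m)"
      using H_conj[of "vector [1/3, 0]"] H_comb[of "vector [1/3, 0]" 3 1] by (simp add: m_def)
    also have "\<dots> = vector [1, 1/3] + vector [10 * m $ 1 + 3 * m $ 2, 3 * m $ 1 + m $ 2]"
      unfolding cat_lift_shift[OF m] by (simp add: cat_lift_def c1)
    finally have "H (vector [1/3, 0]) $ 1 + (3 * H e1 $ 1 + H e2 $ 1) = 1 + (10 * m $ 1 + 3 * m $ 2)"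
      by (simp add: vec2_eq_iff)
    moreover have "H (vector [1/3, 0]) $ 1 = m $ 1" by (simp add: m_def)
    ultimately show thesis using that[of "m $ 1" "m $ 2"] m by simp
  qed
  \<comment> \<open>In the same way the displacements \<open>(1, 0)\<close> of
    \<open>(0, 1/3)\<close> and \<open>(- 3, - 1)\<close> of \<open>(- 1/3, 0)\<close> show that
    \<open>H e1 $ 2\<close> is -1 modulo 3.\<close>
  obtain c where c: "c \<in> \<int>" "H e1 $ 2 = - 1 + 3 * c"
  proof -
    define m where "m = H (vector [0, 1/3]) - vector [- 1/3, 0]"
    have m: "\<forall>i. m $ i \<in> \<int>"
      using h2 H_proj[of "vector [0, 1/3]"] by (simp add: m_def torus_proj_eq_iff)
    have "?F (vector [0, 1/3]) = vector [0, 1/3] + (real 1 *\<^sub>R e1 + real 0 *\<^sub>R e2)"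
      by (simp add: cat_lift_def vec2_eq_iff e1_def e2_def c1)
    then have "H (vector [0, 1/3]) + (real 1 *\<^sub>R H e1 + real 0 *\<^sub>R H e2) = ?G (vector [- 1/3, 0] + m)"
      using H_conj[of "vector [0, 1/3]"] H_comb[of "vector [0, 1/3]" 1 0] by (simp add: m_def)
    also have "\<dots> = vector [- 1/3 - 3, - 1] + vector [10 * m $ 1 + 3 * m $ 2, 3 * m $ 1 + m $ 2]"
      unfolding cat_lift_shift[OF m] by (simp add: cat_lift_def c1)
    finally have "H (vector [0, 1/3]) $ 2 + H e1 $ 2 = - 1 + (3 * m $ 1 + m $ 2)"
      by (simp add: vec2_eq_iff)
    moreover have "H (vector [0, 1/3]) $ 2 = m $ 2" by (simp add: m_def)
    ultimately show thesis using that[of "m $ 1"] m by simp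
  qed
  obtain p a' b' c' :: int where "H e1 $ 1 = of_int p" "a = of_int a'" "b = of_int b'" "c = of_int c'"
    using H_int[OF e_int(1), of 1] ab(1,2) c(1) by (auto elim!: Ints_cases)
  then have "(of_int (3 * p + (- 1 + 3 * c')) :: real) = of_int (1 + 9 * a' + 3 * b')"
    using ab(3) c(2) eq1 by simp
  then have "3 * p + (- 1 + 3 * c') = 1 + 9 * a' + 3 * b'" by (simp only: of_int_eq_iff)
  then show False by presburger
qed

section \<open>The reversing conjugacy\<close>

definition rotation :: "real^2 \<Rightarrow> real^2" where "rotation v = vector [- v $ 2, v $ 1]"
definition inv_rotation :: "real^2 \<Rightarrow> real^2" where "inv_rotation v = vector [v $ 2, - v $ 1]"

abbreviation "rot \<equiv> torus_map rotation"
abbreviation "inv_rot \<equiv> torus_map inv_rotation"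

lemma rotation_respects_lattice: "respects_lattice rotation" "respects_lattice inv_rotation"
  by (simp_all add: respects_lattice_def torus_proj_eq_iff forall_2 rotation_def inv_rotation_def
      Ints_minus algebra_simps)

lemmas rot_proj = rotation_respects_lattice(1)[THEN torus_map_proj]
  and inv_rot_proj = rotation_respects_lattice(2)[THEN torus_map_proj]

lemma rotation_continuous: "continuous_on UNIV rotation" "continuous_on UNIV inv_rotation"
  unfolding rotation_def inv_rotation_def by (intro continuous_intros)+

lemma rot_continuous: "continuous_on UNIV rot" "continuous_on UNIV inv_rot"
  by (rule torus_continuousI, simp add: rot_proj inv_rot_proj,
      rule continuous_on_compose2[OF continuous_torus_proj], rule rotation_continuous, simp)+

lemma rot_inverse: "inv_rot (rot p) = p" "rot (inv_rot p) = p"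
  using torus_proj_surj[of p]
  by (auto simp: rot_proj inv_rot_proj rotation_def inv_rotation_def vector_2_eta)

text \<open>In rotated coordinates the first shear of the new map undoes the second shear of the old
  one, by \<open>circle_map_minus\<close>, and then its second shear undoes the first.\<close>

lemma rotation_reverses_cat_lift:
  "cat_lift (- \<epsilon>) \<delta> (rotation (cat_lift \<delta> \<epsilon> v)) = rotation v"
  using circle_map_minus[of "- \<epsilon>" "v $ 2 + circle_map \<delta> (v $ 1)"]
  by (simp add: cat_lift_def rotation_def vec2_eq_iff)

lemma rot_reverses_cat_map: "cat_map (- \<epsilon>) \<delta> (rot (cat_map \<delta> \<epsilon> p)) = rot p"
  using torus_proj_surj[of p] by (auto simp: cat_map_proj rot_proj rotation_reverses_cat_lift)

lemma rot_swaps_derivs: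
  "cat_fst_deriv (- \<epsilon>) (rot (cat_map \<delta> \<epsilon> p)) = cat_snd_deriv \<delta> \<epsilon> p"
  "cat_snd_deriv (- \<epsilon>) \<delta> (rot (cat_map \<delta> \<epsilon> p)) = cat_fst_deriv \<delta> p"
proof -
  obtain v where v: "torus_proj v = p" using torus_proj_surj by blast
  show "cat_fst_deriv (- \<epsilon>) (rot (cat_map \<delta> \<epsilon> p)) = cat_snd_deriv \<delta> \<epsilon> p"
    unfolding v[symmetric] cat_map_proj rot_proj cat_deriv_proj
    using circle_deriv_minus[of "- \<epsilon>" "v $ 2 + circle_map \<delta> (v $ 1)"]
    by (simp add: rotation_def cat_lift_def)
  have "cat_snd_deriv (- \<epsilon>) \<delta> (rot (cat_map \<delta> \<epsilon> p)) = circle_deriv \<delta> (cat_lift (- \<epsilon>) \<delta> (rotation (cat_lift \<delta> \<epsilon> v)) $ 2)"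
    unfolding v[symmetric] cat_map_proj rot_proj cat_deriv_proj by (simp add: cat_lift_def)
  then show "cat_snd_deriv (- \<epsilon>) \<delta> (rot (cat_map \<delta> \<epsilon> p)) = cat_fst_deriv \<delta> p"
    unfolding rotation_reverses_cat_lift v[symmetric] cat_deriv_proj by (simp add: rotation_def)
qed

lemma cat_map_reversing_conjugacy:
  "reversing_conjugacy (cat_map \<delta> \<epsilon>) (cat_inv_map \<delta> \<epsilon>) (cat_map (- \<epsilon>) \<delta>) (cat_inv_map (- \<epsilon>) \<delta>) rot inv_rot"
  by standard
    (simp_all add: borel_measurable_continuous_onI cat_map_continuous rot_continuous cat_map_inverse
      rot_inverse rot_reverses_cat_map)

context
  fixes \<delta> \<epsilon> :: real
  assumes small: "\<bar>\<delta>\<bar> \<le> 3/4" "\<bar>\<epsilon>\<bar> \<le> 3/4"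
begin

text \<open>The rotation sends \<open>(- \<sigma>, 1)\<close> to a multiple of
  \<open>(1, \<sigma>)\<close>, and \<open>(1, s)\<close> to \<open>(- s, 1)\<close>. Reversing time
  exchanges expansion and contraction, so the two slopes swap roles.\<close>

lemma reversed_slope_system:
  assumes "slope_system (cat_map \<delta> \<epsilon>) (cat_fst_deriv \<delta>) (cat_snd_deriv \<delta> \<epsilon>) s \<sigma>"
  shows "slope_system (cat_map (- \<epsilon>) \<delta>) (cat_fst_deriv (- \<epsilon>)) (cat_snd_deriv (- \<epsilon>) \<delta>)
           (\<lambda>q. \<sigma> (inv_rot q)) (\<lambda>q. s (inv_rot q))"
proof -
  interpret slope_system "cat_map \<delta> \<epsilon>" "cat_fst_deriv \<delta>" "cat_snd_deriv \<delta> \<epsilon>" s \<sigma> by (rule assms)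
  let ?S = "cat_map (- \<epsilon>) \<delta>" and ?a = "cat_fst_deriv (- \<epsilon>)" and ?b = "cat_snd_deriv (- \<epsilon>) \<delta>"
  have small': "\<bar>- \<epsilon>\<bar> \<le> 3/4" using small by simp
  show ?thesis
  proof
    show "torus_diffeo ?S" by (rule torus_diffeo_cat_map)
    show "has_torus_deriv ?S (vector [vector [1 + ?a p * ?b p, ?b p], vector [?a p, 1]]) p" for p
      using cat_has_torus_deriv[of "- \<epsilon>" \<delta> p] by (simp add: cat_matrix_def Let_def)
    show "continuous_on UNIV (\<lambda>q. \<sigma> (inv_rot q))" "continuous_on UNIV (\<lambda>q. s (inv_rot q))"
      by (rule continuous_on_compose2[OF cont(2) rot_continuous(2)]
          continuous_on_compose2[OF cont(1) rot_continuous(2)], simp)+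
    show "1 \<le> ?a p" "1 \<le> ?b p" for p using cat_deriv_bounds[OF small' small(1)] by auto
    show "0 \<le> \<sigma> (inv_rot p)" "\<sigma> (inv_rot p) \<le> 1" "0 \<le> s (inv_rot p)" "s (inv_rot p) \<le> 1" for p
      by (rule slope_bounds)+
  next
    fix q
    \<comment> \<open>Every point has the form \<open>rot (cat_map \<delta> \<epsilon> p)\<close> to
      which the reversal identities apply.\<close>
    define p where "p = cat_inv_map \<delta> \<epsilon> (inv_rot q)"
    have q: "q = rot (cat_map \<delta> \<epsilon> p)" by (simp add: p_def cat_map_inverse rot_inverse)
    show "\<sigma> (inv_rot (?S q)) = (?a q + \<sigma> (inv_rot q)) / (1 + ?b q * (?a q + \<sigma> (inv_rot q)))"
      using \<sigma>_eq[of p] by (simp only: q rot_reverses_cat_map rot_swaps_derivs rot_inverse)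
    show "s (inv_rot q) = (?b q + s (inv_rot (?S q))) / (1 + ?a q * (?b q + s (inv_rot (?S q))))"
      using s_eq[of p] by (simp only: q rot_reverses_cat_map rot_swaps_derivs rot_inverse)
  qed
qed

lemma anosov_cat_map: "anosov (cat_map \<delta> \<epsilon>)"
  using cat_slope_system_exists[OF small] slope_system.anosov by metis

text \<open>The logarithms of the multipliers differ by a coboundary because \<open>cat_map\<close> preserves area.\<close>

lemma geometric_potential_reverse:
  obtains w where "continuous_on UNIV w" "bounded (range w)" "continuous_on UNIV (geometric_potential (cat_map \<delta> \<epsilon>))"
    "bounded (range (geometric_potential (cat_map \<delta> \<epsilon>)))"
    "\<And>p. geometric_potential (cat_map (- \<epsilon>) \<delta>) (rot (cat_map \<delta> \<epsilon> p))
         = geometric_potential (cat_map \<delta> \<epsilon>) p + w (cat_map \<delta> \<epsilon> p) - w p"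
proof -
  obtain s \<sigma> where sys: "slope_system (cat_map \<delta> \<epsilon>) (cat_fst_deriv \<delta>) (cat_snd_deriv \<delta> \<epsilon>) s \<sigma>"
    by (rule cat_slope_system_exists[OF small])
  interpret slope_system "cat_map \<delta> \<epsilon>" "cat_fst_deriv \<delta>" "cat_snd_deriv \<delta> \<epsilon>" s \<sigma> by (rule sys)
  interpret rev: slope_system "cat_map (- \<epsilon>) \<delta>" "cat_fst_deriv (- \<epsilon>)" "cat_snd_deriv (- \<epsilon>) \<delta>"
    "\<lambda>q. \<sigma> (inv_rot q)" "\<lambda>q. s (inv_rot q)" by (rule reversed_slope_system[OF sys])
  let ?T = "cat_map \<delta> \<epsilon>" and ?S = "cat_map (- \<epsilon>) \<delta>"
  \<comment> \<open>Besides the normalisations of the two expanding vectors, \<open>w\<close>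
    contains the logarithm of the parallelogram area that relates \<open>A\<close> to
    \<open>B\<close> in \<open>A_B\<close>.\<close>
  define w where "w p = ln (norm (rev.u (rot p))) + ln (norm (u p)) - ln (1 + s p * \<sigma> p)" for p
  \<comment> \<open>The reversed map expands by the reciprocal of the factor by which the original
    map contracts.\<close>
  have A_rev: "rev.A (rot (?T p)) = B p" for p
    by (simp add: rev.A_def B_def rot_swaps_derivs rot_inverse)
  have pos: "0 < 1 + s p * \<sigma> p" for p using slope_bounds[of p] by (simp add: add_pos_nonneg)
  have AB: "ln (A p) + ln (1 + s (?T p) * \<sigma> (?T p)) = ln (B p) + ln (1 + s p * \<sigma> p)" for p
  proof -
    have "ln (A p * (1 + s (?T p) * \<sigma> (?T p))) = ln (B p * (1 + s p * \<sigma> p))" by (simp only: A_B)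
    then show ?thesis using A_ge[of p] B_ge[of p] pos[of p] pos[of "?T p"] by (simp add: ln_mult)
  qed
  have ln_bounds: "0 \<le> ln x \<and> ln x \<le> 2" if "1 \<le> x" "x \<le> 2" for x :: real
    using that ln_le_minus_one[of x] by auto
  show thesis
  proof
    have "continuous_on UNIV (\<lambda>p. rev.u (rot p))"
      unfolding rev.u_def by (intro continuous_intros) (simp add: rot_inverse cont)
    moreover have cont_u: "continuous_on UNIV u" unfolding u_def by (intro continuous_intros cont)
    moreover have "norm (rev.u p) \<noteq> 0" "norm (u p) \<noteq> 0" "1 + s p * \<sigma> p \<noteq> 0" for p
      using rev.norm_u(1)[of p] norm_u(1)[of p] pos[of p] by linarith+
    ultimately show "continuous_on UNIV w"
      unfolding w_def by (intro continuous_intros cont) auto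
    have "\<bar>w p\<bar> \<le> 4" for p
    proof -
      have "s p * \<sigma> p \<le> 1 * 1" using slope_bounds[of p] by (intro mult_mono) auto
      then have "1 \<le> 1 + s p * \<sigma> p" "1 + s p * \<sigma> p \<le> 2" using slope_bounds[of p] by auto
      then show ?thesis
        using ln_bounds[OF rev.norm_u, of "rot p"] ln_bounds[OF norm_u, of p] ln_bounds[of "1 + s p * \<sigma> p"]
        unfolding w_def by linarith
    qed
    then show "bounded (range w)" by (intro boundedI[of _ 4]) auto
    \<comment> \<open>Here \<open>31 = 1 + 5 * (5 + 1)\<close>. This and the bound 34 below are
      generous; they serve integrability.\<close>
    have A_le: "A p \<le> 31" for p
    proof -
      have "cat_snd_deriv \<delta> \<epsilon> p * (cat_fst_deriv \<delta> p + s p) \<le> 5 * (5 + 1)"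
        using cat_deriv_bounds[OF small, of p] slope_bounds[of p] by (intro mult_mono) auto
      then show ?thesis by (simp add: A_def)
    qed
    have "\<bar>geometric_potential ?T p\<bar> \<le> 34" for p
      unfolding geometric_potential
      using ln_bounds[OF norm_u, of p] ln_bounds[OF norm_u, of "?T p"] A_le[of p] A_ge[of p] ln_le_minus_one[of "A p"]
        ln_ge_zero[of "A p"] by linarith
    then show "bounded (range (geometric_potential ?T))" by (intro boundedI[of _ 34]) auto
    have "continuous_on UNIV A"
      unfolding A_def by (intro continuous_intros cat_deriv_continuous cont)
    moreover have "continuous_on UNIV (\<lambda>p. u (?T p))"
      by (rule continuous_on_compose2[OF cont_u cat_map_continuous(1)]) simp
    moreover have "A p \<noteq> 0" "norm (u p) \<noteq> 0" for p using A_ge[of p] norm_u(1)[of p] by linarith+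
    moreover have "geometric_potential ?T = (\<lambda>p. - ln (A p) - ln (norm (u (?T p))) + ln (norm (u p)))"
      using geometric_potential by blast
    ultimately show "continuous_on UNIV (geometric_potential ?T)"
      using cont_u by (simp only:) (intro continuous_intros; simp)
    show "geometric_potential ?S (rot (?T p)) = geometric_potential ?T p + w (?T p) - w p" for p
      using AB[of p] unfolding rev.geometric_potential geometric_potential A_rev rot_reverses_cat_map w_def
      by simp
  qed
qed

text \<open>A coboundary integrates to 0 against an invariant measure.\<close>

lemma integral_geometric_potential_reverse:
  assumes M: "M \<in> invariant_prob_measures (cat_map \<delta> \<epsilon>)"
  shows "(\<integral>p. t * geometric_potential (cat_map \<delta> \<epsilon>) p \<partial>M)
     = (\<integral>q. t * geometric_potential (cat_map (- \<epsilon>) \<delta>) q \<partial>distr M borel rot)"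
proof -
  let ?T = "cat_map \<delta> \<epsilon>" and ?S = "cat_map (- \<epsilon>) \<delta>"
  let ?\<phi> = "geometric_potential ?T" and ?\<psi> = "geometric_potential ?S"
  have sets_M: "sets M = sets borel" and "prob_space M" and inv: "distr M M ?T = M"
    using M by (auto simp: invariant_prob_measures_def preserves_measure_def)
  interpret prob_space M by fact
  have meas: "f \<in> measurable M N" if "f \<in> measurable borel N" for f :: "torus \<Rightarrow> 'b" and N
    using that by (simp add: measurable_cong_sets[OF sets_M refl])
  obtain w where w: "continuous_on UNIV w" "bounded (range w)" "continuous_on UNIV ?\<phi>" "bounded (range ?\<phi>)"
    and coboundary: "\<And>p. ?\<psi> (rot (?T p)) = ?\<phi> p + w (?T p) - w p"
    using geometric_potential_reverse by blast
  have T: "?T \<in> measurable M M" "rot \<in> measurable M borel"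
    using measurable_cong_sets[OF sets_M sets_M] cat_map_continuous(1) rot_continuous(1)
    by (auto intro!: borel_measurable_continuous_onI meas)
  have integrable: "integrable M f" if f: "continuous_on UNIV f" "bounded (range f)" for f :: "torus \<Rightarrow> real"
  proof -
    obtain C where "\<And>p. norm (f p) \<le> C" using f(2) by (auto simp: bounded_iff)
    then show ?thesis
      using f(1) by (intro integrable_const_bound[of _ C] meas borel_measurable_continuous_onI) auto
  qed
  have invariant: "(\<integral>p. f (?T p) \<partial>M) = (\<integral>p. f p \<partial>M)" if "f \<in> borel_measurable borel" for f :: "torus \<Rightarrow> real"
    using integral_distr[OF T(1) meas[OF that]] by (simp add: inv)
  have wT: "integrable M (\<lambda>p. w (?T p))"
  proof (rule integrable)
    show "continuous_on UNIV (\<lambda>p. w (?T p))"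
      by (rule continuous_on_compose2[OF w(1) cat_map_continuous(1)]) simp
    show "bounded (range (\<lambda>p. w (?T p)))" using w(2) by (rule bounded_subset) auto
  qed
  interpret conj: reversing_conjugacy ?T "cat_inv_map \<delta> \<epsilon>" ?S "cat_inv_map (- \<epsilon>) \<delta>" rot inv_rot
    by (rule cat_map_reversing_conjugacy)
  \<comment> \<open>The coboundary identity, solved for \<open>?\<psi>\<close>, exhibits it as a
    Borel function.\<close>
  have "?\<psi> = (\<lambda>q. ?\<phi> (cat_inv_map \<delta> \<epsilon> (inv_rot q)) + w (inv_rot q) - w (cat_inv_map \<delta> \<epsilon> (inv_rot q)))"
  proof
    fix q
    show "?\<psi> q = ?\<phi> (cat_inv_map \<delta> \<epsilon> (inv_rot q)) + w (inv_rot q) - w (cat_inv_map \<delta> \<epsilon> (inv_rot q))"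
      using coboundary[of "cat_inv_map \<delta> \<epsilon> (inv_rot q)"] by (simp add: cat_map_inverse rot_inverse)
  qed
  moreover have [measurable]: "?\<phi> \<in> borel_measurable borel" "w \<in> borel_measurable borel"
    using w by (auto intro: borel_measurable_continuous_onI)
  ultimately have \<psi> [measurable]: "?\<psi> \<in> borel_measurable borel"
    by (simp only:) measurable
  have "(\<integral>q. ?\<psi> q \<partial>distr M borel rot) = (\<integral>p. ?\<psi> (rot p) \<partial>M)"
    by (rule integral_distr[OF T(2) \<psi>])
  \<comment> \<open>Invariance of \<open>M\<close> inserts \<open>?T\<close>, since the coboundary
    identity concerns the points \<open>rot (?T p)\<close>.\<close>
  also have "\<dots> = (\<integral>p. ?\<psi> (rot (?T p)) \<partial>M)"
    by (rule invariant[symmetric]) measurable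
  also have "\<dots> = (\<integral>p. ?\<phi> p \<partial>M) + (\<integral>p. w (?T p) \<partial>M) - (\<integral>p. w p \<partial>M)"
    unfolding coboundary using integrable[OF w(1,2)] integrable[OF w(3,4)] wT by simp
  also have "\<dots> = (\<integral>p. ?\<phi> p \<partial>M)" using invariant[of w] by simp
  finally show ?thesis by simp
qed

lemma topological_pressure_reverse:
  "topological_pressure (cat_map \<delta> \<epsilon>) (\<lambda>x. t * geometric_potential (cat_map \<delta> \<epsilon>) x)
   = topological_pressure (cat_map (- \<epsilon>) \<delta>) (\<lambda>x. t * geometric_potential (cat_map (- \<epsilon>) \<delta>) x)"
  by (rule reversing_conjugacy.topological_pressure_eq[OF cat_map_reversing_conjugacy
        integral_geometric_potential_reverse])

end

theorem theorem2:
  shows "\<exists>T\<^sub>1 T\<^sub>2 :: torus \<Rightarrow> torus.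
    torus_C1H T\<^sub>1 \<and> anosov T\<^sub>1 \<and> preserves_measure T\<^sub>1 torus_lebesgue \<and>
    torus_C1H T\<^sub>2 \<and> anosov T\<^sub>2 \<and> preserves_measure T\<^sub>2 torus_lebesgue \<and>
    homotopic_with_canon (\<lambda>_. True) UNIV UNIV T\<^sub>1 T\<^sub>2 \<and>
    (\<forall>t::real. topological_pressure T\<^sub>1 (\<lambda>x. t * geometric_potential T\<^sub>1 x)
             = topological_pressure T\<^sub>2 (\<lambda>x. t * geometric_potential T\<^sub>2 x)) \<and>
    \<not> C1_conjugate T\<^sub>1 T\<^sub>2"
proof (intro exI conjI allI)
  \<comment> \<open>\<open>?S\<close> is the time reversal of \<open>?T\<close>, with parameters
    \<open>- \<epsilon>\<close> and \<open>\<delta>\<close>. All parameters obey the bound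
    \<open>3/4\<close> of the derivative estimates, and the different sizes \<open>3/4\<close> and
    \<open>1/2\<close> tell the fixed points \<open>(1/3, 0)\<close> and \<open>(0, 1/3)\<close>
    apart by their traces.\<close>
  let ?T = "cat_map (3/4) (1/2)" and ?S = "cat_map (- (1/2)) (3/4)"
  show "torus_C1H ?T" "torus_C1H ?S" by (simp_all add: torus_C1H_cat_map)
  show "anosov ?T" "anosov ?S" by (simp_all add: anosov_cat_map)
  show "preserves_measure ?T torus_lebesgue" "preserves_measure ?S torus_lebesgue"
    by (rule cat_map_preserves_lebesgue)+
  show "homotopic_with_canon (\<lambda>_. True) UNIV UNIV ?T ?S" by (rule homotopic_cat_maps)
  show "topological_pressure ?T (\<lambda>x. t * geometric_potential ?T x)
      = topological_pressure ?S (\<lambda>x. t * geometric_potential ?S x)" for t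
    by (rule topological_pressure_reverse) simp_all
  show "\<not> C1_conjugate ?T ?S" using cat_maps_not_C1_conjugate by simp
qed

end
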